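(* Let $\Gamma$ be a linearly ordered abelian group, $F=\mathbb R((\Gamma))$ the field of formal Laurent series with real coefficients and exponents in $\Gamma$, and $n$ a positive integer. For every nonzero $A\in M_{\ast,n}(F)$ there exists a unique archimedean canonical form $C\in M_{\ast,n}(F)$ such that $A\sim_n C$.
   Context: $F=\mathbb R((\Gamma))$ consists of formal series $\sum_{\gamma\in\Gamma}a_\gamma t^\gamma$ with $a_\gamma\in\mathbb R$ and well-ordered support; it is ordered by the sign of the coefficient of the lowest exponent with nonzero coefficient. $M_{\ast,n}(F)=\bigcup_{m\ge 1}M_{m,n}(F)$. For symmetric $S,T\in M_n(F)$ write $S\le_n T$ iff $T-S$ is positive semidefinite, i.e. $v^T(T-S)v\ge 0$ for all $v\in F^n$. For $A,B\in M_{\ast,n}(F)$ write $A\succeq_n B$ iff there is $r\in\mathbb N$ with $A^TA\le_n rB^TB$, and $A\sim_n B$ iff $A\succeq_n B$ and $B\succeq_n A$. A matrix is a row echelon form if all its zero rows are at the bottom and, for each $i$, the first nonzero element of the $(i+1)$-th nonzero row lies strictly to the right of the first nonzero element of the $i$-th nonzero row; the first nonzero element of the $i$-th nonzero row is the $i$-th pivot. A row echelon form $C=[c_{ij}]\in M_{\ast,n}(F)$ with pivots $c_{i,k_i}$, $i=1,\dots,r$, is an archimedean canonical form if it has no zero rows and there exist $m_1,\dots,m_r\in\Gamma$ such that (i) $c_{i,k_i}=t^{m_i}$ for each $i$, and (ii) for each $i$ and every $j<i$, the entry $c_{j,k_i}$ has no terms (with nonzero coefficient) with exponents $\ge m_i$.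 *)

theory Defs
  imports Complex_Main "Jordan_Normal_Form.Matrix"
begin

section \<open>Formal series with well-ordered support\<close>

text \<open>On a linear order, a subset is well-ordered iff the strict order is well-founded on it.\<close>

typedef (overloaded) 'g hahn = "{f :: 'g::linorder \<Rightarrow> real. wfp_on {\<gamma>. f \<gamma> \<noteq> 0} (<)}"
  morphisms hcoeff Abs_hahn
  by (rule exI[of _ "\<lambda>_. 0"]) (simp add: wfp_on_def)

setup_lifting type_definition_hahn

abbreviation supp :: "'g::linorder hahn \<Rightarrow> 'g set" where
  "supp f \<equiv> {\<gamma>. hcoeff f \<gamma> \<noteq> 0}"

lemma hahn_eqI: "(\<And>\<gamma>. hcoeff f \<gamma> = hcoeff g \<gamma>) \<Longrightarrow> f = g"
  by (simp add: hcoeff_inject[symmetric] fun_eq_iff)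

lemma wfp_on_supp: "wfp_on (supp f) (<)"
  using hcoeff[of f] by simp

lemma wo_least:
  fixes A :: "'g::linorder set"
  assumes "wfp_on A (<)" "B \<subseteq> A" "B \<noteq> {}"
  obtains z where "z \<in> B" "\<And>y. y \<in> B \<Longrightarrow> z \<le> y"
  using assms unfolding wfp_on_iff_ex_minimal by (meson linorder_not_less)

lemma woI:
  fixes A :: "'g::linorder set"
  assumes "\<And>B. B \<subseteq> A \<Longrightarrow> B \<noteq> {} \<Longrightarrow> \<exists>z\<in>B. \<forall>y\<in>B. z \<le> y"
  shows "wfp_on A (<)"
  unfolding wfp_on_iff_ex_minimal using assms by (meson linorder_not_less)

lemma wo_no_descent:
  fixes s :: "nat \<Rightarrow> 'g::linorder"
  assumes "wfp_on A (<)" "\<And>n. s n \<in> A" "\<And>n. s (Suc n) < s n"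
  shows False
proof -
  obtain z where "z \<in> range s" "\<And>y. y \<in> range s \<Longrightarrow> z \<le> y"
    using wo_least[OF assms(1), of "range s"] assms(2) by blast
  then obtain n where "\<And>y. y \<in> range s \<Longrightarrow> s n \<le> y" by auto
  from this[of "s (Suc n)"] assms(3)[of n] show False by simp
qed

lemma woI_descent:
  fixes A :: "'g::linorder set"
  assumes "\<And>s. (\<And>n::nat. s n \<in> A) \<Longrightarrow> (\<And>n. s (Suc n) < s n) \<Longrightarrow> False"
  shows "wfp_on A (<)"
proof (rule woI, rule ccontr)
  fix B assume B: "B \<subseteq> A" "B \<noteq> {}" and "\<not> (\<exists>z\<in>B. \<forall>y\<in>B. z \<le> y)"
  then have *: "\<exists>y. y \<in> B \<and> y < x" if "x \<in> B" for x
    using that by (meson linorder_not_le)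
  obtain x0 where "x0 \<in> B" using B by blast
  then obtain s :: "nat \<Rightarrow> 'g" where "\<And>n. s n \<in> B" "\<And>n. s (Suc n) < s n"
    using dependent_nat_choice[of "\<lambda>_ x. x \<in> B" "\<lambda>_ x y. y < x"] * by blast
  then show False using assms B by blast
qed

lemma wo_mono_subseq:
  fixes s :: "nat \<Rightarrow> 'g::linorder"
  assumes A: "wfp_on A (<)" "\<And>n. s n \<in> A"
  obtains r :: "nat \<Rightarrow> nat" where "strict_mono r" "\<And>m n. m \<le> n \<Longrightarrow> s (r m) \<le> s (r n)"
proof -
  obtain f where f: "strict_mono f" "monoseq (\<lambda>n. s (f n))"
    using seq_monosub by blast
  show ?thesis
  proof (cases "\<forall>m n. m \<le> n \<longrightarrow> s (f m) \<le> s (f n)")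
    case True
    then show ?thesis using f(1) that by blast
  next
    case False
    with f(2) have dec: "\<And>m n. m \<le> n \<Longrightarrow> s (f n) \<le> s (f m)"
      unfolding monoseq_def by blast
    obtain z where z: "z \<in> range (\<lambda>n. s (f n))" "\<And>y. y \<in> range (\<lambda>n. s (f n)) \<Longrightarrow> z \<le> y"
      using wo_least[OF A(1), of "range (\<lambda>n. s (f n))"] A(2) by blast
    then obtain k where k: "\<And>n. s (f k) \<le> s (f n)" by auto
    show ?thesis
    proof (rule that[of "\<lambda>n. f (k + n)"])
      show "strict_mono (\<lambda>n. f (k + n))"
        using f(1) by (simp add: strict_mono_def)
      show "s (f (k + m)) \<le> s (f (k + n))" if "m \<le> n" for m n
        using dec[of k "k + m"] k[of "k + n"] by simp
    qed
  qed
qed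

lemma wo_sumset:
  fixes A B :: "'g::linordered_ab_group_add set"
  assumes A: "wfp_on A (<)" and B: "wfp_on B (<)"
  shows "wfp_on {a + b |a b. a \<in> A \<and> b \<in> B} (<)"
proof (rule woI_descent)
  fix s :: "nat \<Rightarrow> 'g"
  assume s: "\<And>n. s n \<in> {a + b |a b. a \<in> A \<and> b \<in> B}" "\<And>n. s (Suc n) < s n"
  have "\<exists>a b. \<forall>n. a n \<in> A \<and> b n \<in> B \<and> s n = a n + b n"
    using s(1) by simp metis
  then obtain a b where ab: "\<And>n. a n \<in> A" "\<And>n. b n \<in> B" "\<And>n. s n = a n + b n"
    by blast
  obtain r :: "nat \<Rightarrow> nat" where r: "strict_mono r" "\<And>m n. m \<le> n \<Longrightarrow> a (r m) \<le> a (r n)"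
    using wo_mono_subseq[OF A, of a] ab(1) by blast
  have dec: "s n < s m" if "m < n" for m n
    using that s(2) by (rule lift_Suc_mono_less[of "\<lambda>n. - s n", simplified, rotated])
  show False
  proof (rule wo_no_descent[OF B, of "\<lambda>n. b (r n)"])
    show "b (r n) \<in> B" for n by (rule ab)
    fix n
    have "a (r (Suc n)) + b (r (Suc n)) < a (r n) + b (r n)"
      using dec[of "r n" "r (Suc n)"] r(1) by (simp add: ab(3) strict_mono_def)
    moreover have "a (r n) \<le> a (r (Suc n))" using r(2) by simp
    ultimately show "b (r (Suc n)) < b (r n)"
      by (meson add_mono linorder_not_less)
  qed
qed

lemma finite_decomp:
  fixes A B :: "'g::linordered_ab_group_add set"
  assumes A: "wfp_on A (<)" and B: "wfp_on B (<)"
  shows "finite {\<alpha>. \<alpha> \<in> A \<and> \<gamma> - \<alpha> \<in> B}" (is "finite ?S")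
proof (rule ccontr)
  assume "infinite ?S"
  then obtain s :: "nat \<Rightarrow> 'g" where s: "inj s" "range s \<subseteq> ?S"
    using infinite_countable_subset by blast
  have sA: "\<And>n. s n \<in> A" and sB: "\<And>n. \<gamma> - s n \<in> B" using s(2) by auto
  obtain r :: "nat \<Rightarrow> nat" where r: "strict_mono r" "\<And>m n. m \<le> n \<Longrightarrow> s (r m) \<le> s (r n)"
    using wo_mono_subseq[OF A, of s] sA by blast
  show False
  proof (rule wo_no_descent[OF B, of "\<lambda>n. \<gamma> - s (r n)"])
    show "\<gamma> - s (r n) \<in> B" for n by (rule sB)
    fix n
    have "r n \<noteq> r (Suc n)" using r(1) by (metis n_not_Suc_n strict_mono_eq)
    then have "s (r n) \<noteq> s (r (Suc n))" using s(1) by (simp add: inj_eq)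
    with r(2)[of n "Suc n"] show "\<gamma> - s (r (Suc n)) < \<gamma> - s (r n)" by simp
  qed
qed

lemma wo_union:
  fixes A B :: "'g::linorder set"
  assumes A: "wfp_on A (<)" and B: "wfp_on B (<)"
  shows "wfp_on (A \<union> B) (<)"
proof (rule woI)
  fix S assume S: "S \<subseteq> A \<union> B" "S \<noteq> {}"
  show "\<exists>z\<in>S. \<forall>y\<in>S. z \<le> y"
  proof (cases "S \<inter> A = {} \<or> S \<inter> B = {}")
    case True
    then have "S \<subseteq> A \<or> S \<subseteq> B" using S by blast
    then show ?thesis using wo_least[OF A _ S(2)] wo_least[OF B _ S(2)] by metis
  next
    case False
    obtain x where x: "x \<in> S \<inter> A" "\<And>y. y \<in> S \<inter> A \<Longrightarrow> x \<le> y"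
      using wo_least[OF A, of "S \<inter> A"] False by blast
    obtain y where y: "y \<in> S \<inter> B" "\<And>z. z \<in> S \<inter> B \<Longrightarrow> y \<le> z"
      using wo_least[OF B, of "S \<inter> B"] False by blast
    have "min x y \<in> S" using x y by (simp add: min_def)
    moreover have "min x y \<le> z" if "z \<in> S" for z
      using that S(1) x(2)[of z] y(2)[of z] by (auto simp: min_le_iff_disj)
    ultimately show ?thesis by blast
  qed
qed

subsection \<open>The ring structure\<close>

lift_definition hahn_monom :: "'g::linorder \<Rightarrow> real \<Rightarrow> 'g hahn"
  is "\<lambda>\<delta> a \<gamma>. if \<gamma> = \<delta> then a else 0"
  by (rule woI) (fastforce split: if_splits)

lemma hcoeff_monom: "hcoeff (hahn_monom \<delta> a) \<gamma> = (if \<gamma> = \<delta> then a else 0)"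
  by transfer simp

instantiation hahn :: (linordered_ab_group_add) comm_ring_1
begin

lift_definition zero_hahn :: "'a hahn" is "\<lambda>_. 0"
  by (simp add: wfp_on_def)

definition one_hahn :: "'a hahn" where "one_hahn = hahn_monom 0 1"

lift_definition plus_hahn :: "'a hahn \<Rightarrow> 'a hahn \<Rightarrow> 'a hahn" is "\<lambda>f g \<gamma>. f \<gamma> + g \<gamma>"
  by (rule wfp_on_subset, erule (1) wo_union, auto)

lift_definition uminus_hahn :: "'a hahn \<Rightarrow> 'a hahn" is "\<lambda>f \<gamma>. - f \<gamma>"
  by simp

lift_definition minus_hahn :: "'a hahn \<Rightarrow> 'a hahn \<Rightarrow> 'a hahn" is "\<lambda>f g \<gamma>. f \<gamma> - g \<gamma>"
  by (rule wfp_on_subset, erule (1) wo_union, auto)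

text \<open>The index set of the sum is finite by lemma \<open>finite_decomp\<close>.\<close>

lift_definition times_hahn :: "'a hahn \<Rightarrow> 'a hahn \<Rightarrow> 'a hahn"
  is "\<lambda>f g \<gamma>. \<Sum>\<alpha> | f \<alpha> \<noteq> 0 \<and> g (\<gamma> - \<alpha>) \<noteq> 0. f \<alpha> * g (\<gamma> - \<alpha>)"
proof -
  fix f g :: "'a \<Rightarrow> real"
  assume fg: "wfp_on {\<gamma>. f \<gamma> \<noteq> 0} (<)" "wfp_on {\<gamma>. g \<gamma> \<noteq> 0} (<)"
  show "wfp_on {\<gamma>. (\<Sum>\<alpha> | f \<alpha> \<noteq> 0 \<and> g (\<gamma> - \<alpha>) \<noteq> 0. f \<alpha> * g (\<gamma> - \<alpha>)) \<noteq> 0} (<)"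
  proof (rule wfp_on_subset[OF wo_sumset[OF fg]], rule subsetI)
    fix \<gamma> assume "\<gamma> \<in> {\<gamma>. (\<Sum>\<alpha> | f \<alpha> \<noteq> 0 \<and> g (\<gamma> - \<alpha>) \<noteq> 0. f \<alpha> * g (\<gamma> - \<alpha>)) \<noteq> 0}"
    then obtain \<alpha> where "f \<alpha> \<noteq> 0" "g (\<gamma> - \<alpha>) \<noteq> 0"
      by (smt (verit, best) mem_Collect_eq sum.neutral)
    then have "\<gamma> = \<alpha> + (\<gamma> - \<alpha>) \<and> \<alpha> \<in> {\<gamma>. f \<gamma> \<noteq> 0} \<and> \<gamma> - \<alpha> \<in> {\<gamma>. g \<gamma> \<noteq> 0}" by simp
    then show "\<gamma> \<in> {a + b |a b. a \<in> {\<gamma>. f \<gamma> \<noteq> 0} \<and> b \<in> {\<gamma>. g \<gamma> \<noteq> 0}}" by blast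
  qed
qed

lemma hcoeff_zero [simp]: "hcoeff (0 :: 'a hahn) \<gamma> = 0"
  by transfer simp

lemma hcoeff_one: "hcoeff (1 :: 'a hahn) \<gamma> = (if \<gamma> = 0 then 1 else 0)"
  by (simp add: one_hahn_def hcoeff_monom)

lemma hcoeff_plus [simp]: "hcoeff (f + g :: 'a hahn) \<gamma> = hcoeff f \<gamma> + hcoeff g \<gamma>"
  by transfer simp

lemma hcoeff_minus [simp]: "hcoeff (f - g :: 'a hahn) \<gamma> = hcoeff f \<gamma> - hcoeff g \<gamma>"
  by transfer simp

lemma hcoeff_uminus [simp]: "hcoeff (- f :: 'a hahn) \<gamma> = - hcoeff f \<gamma>"
  by transfer simp

lemma finite_times_index: "finite {\<alpha>. hcoeff f \<alpha> \<noteq> 0 \<and> hcoeff g (\<gamma> - \<alpha> :: 'a) \<noteq> 0}"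
  using finite_decomp[OF wfp_on_supp[of f] wfp_on_supp[of g], of \<gamma>] by simp

lemma hcoeff_times: "hcoeff (f * g :: 'a hahn) \<gamma> =
    (\<Sum>\<alpha> | hcoeff f \<alpha> \<noteq> 0 \<and> hcoeff g (\<gamma> - \<alpha>) \<noteq> 0. hcoeff f \<alpha> * hcoeff g (\<gamma> - \<alpha>))"
  by transfer simp

lemma hcoeff_times': 
  assumes "finite T" "{\<alpha>. hcoeff f \<alpha> \<noteq> 0 \<and> hcoeff g (\<gamma> - \<alpha>) \<noteq> 0} \<subseteq> T"
  shows "hcoeff (f * g :: 'a hahn) \<gamma> = (\<Sum>\<alpha>\<in>T. hcoeff f \<alpha> * hcoeff g (\<gamma> - \<alpha>))"
  unfolding hcoeff_times using assms by (intro sum.mono_neutral_left) auto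

lemma hahn_mult_commute: "f * g = g * (f :: 'a hahn)"
proof (rule hahn_eqI)
  fix \<gamma>
  show "hcoeff (f * g) \<gamma> = hcoeff (g * f) \<gamma>"
    unfolding hcoeff_times
    by (rule sum.reindex_bij_witness[of _ "\<lambda>\<alpha>. \<gamma> - \<alpha>" "\<lambda>\<alpha>. \<gamma> - \<alpha>"]) auto
qed

lemma hahn_distrib: "(f + g) * h = f * h + g * (h :: 'a hahn)"
proof (rule hahn_eqI)
  fix \<gamma>
  let ?S = "\<lambda>f. {\<alpha>. hcoeff f \<alpha> \<noteq> 0 \<and> hcoeff h (\<gamma> - \<alpha>) \<noteq> 0}"
  let ?T = "?S f \<union> ?S g"
  have fin: "finite ?T" by (simp add: finite_times_index)
  have "hcoeff ((f + g) * h) \<gamma> = (\<Sum>\<alpha>\<in>?T. hcoeff (f + g) \<alpha> * hcoeff h (\<gamma> - \<alpha>))"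
    by (rule hcoeff_times'[OF fin]) auto
  moreover have "hcoeff (f * h) \<gamma> = (\<Sum>\<alpha>\<in>?T. hcoeff f \<alpha> * hcoeff h (\<gamma> - \<alpha>))"
    by (rule hcoeff_times'[OF fin]) auto
  moreover have "hcoeff (g * h) \<gamma> = (\<Sum>\<alpha>\<in>?T. hcoeff g \<alpha> * hcoeff h (\<gamma> - \<alpha>))"
    by (rule hcoeff_times'[OF fin]) auto
  ultimately show "hcoeff ((f + g) * h) \<gamma> = hcoeff (f * h + g * h) \<gamma>"
    by (simp add: sum.distrib algebra_simps)
qed

lemma hcoeff_times_monom: "hcoeff (f * hahn_monom \<delta> a :: 'a hahn) \<gamma> = hcoeff f (\<gamma> - \<delta>) * a"
proof -
  have "hcoeff (f * hahn_monom \<delta> a) \<gamma> =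
      (\<Sum>\<alpha>\<in>{\<gamma> - \<delta>}. hcoeff f \<alpha> * hcoeff (hahn_monom \<delta> a) (\<gamma> - \<alpha>))"
    by (rule hcoeff_times') (auto simp: hcoeff_monom algebra_simps split: if_splits)
  then show ?thesis by (simp add: hcoeff_monom)
qed

lemma hahn_mult_assoc: "(f * g) * h = f * (g * (h :: 'a hahn))"
proof (rule hahn_eqI)
  fix \<gamma>
  let ?sum = "\<lambda>f g. {a + b |a b. a \<in> supp f \<and> b \<in> supp g}"
  let ?U = "\<lambda>f g (\<gamma>::'a). {\<alpha>. hcoeff f \<alpha> \<noteq> 0 \<and> hcoeff g (\<gamma> - \<alpha>) \<noteq> 0}"
  let ?T = "{\<sigma>. \<sigma> \<in> ?sum f g \<and> \<gamma> - \<sigma> \<in> supp h}"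
  let ?T' = "{\<alpha>. \<alpha> \<in> supp f \<and> \<gamma> - \<alpha> \<in> ?sum g h}"
  have fT: "finite ?T" and fT': "finite ?T'"
    by (intro finite_decomp wo_sumset wfp_on_supp)+
  have in_sum: "\<sigma> \<in> ?sum p q" if "hcoeff (p * q) \<sigma> \<noteq> 0" for p q :: "'a hahn" and \<sigma>
  proof -
    from that have "\<exists>\<alpha>. hcoeff p \<alpha> \<noteq> 0 \<and> hcoeff q (\<sigma> - \<alpha>) \<noteq> 0"
      unfolding hcoeff_times by (smt (verit, best) mem_Collect_eq sum.neutral)
    then obtain \<alpha> where "hcoeff p \<alpha> \<noteq> 0" "hcoeff q (\<sigma> - \<alpha>) \<noteq> 0" by blast
    then have "\<sigma> = \<alpha> + (\<sigma> - \<alpha>) \<and> \<alpha> \<in> supp p \<and> \<sigma> - \<alpha> \<in> supp q" by simp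
    then show ?thesis by blast
  qed
  have "hcoeff ((f * g) * h) \<gamma> = (\<Sum>\<sigma>\<in>?T. hcoeff (f * g) \<sigma> * hcoeff h (\<gamma> - \<sigma>))"
    by (rule hcoeff_times'[OF fT]) (use in_sum in blast)
  also have "\<dots> = (\<Sum>\<sigma>\<in>?T. \<Sum>\<alpha>\<in>?U f g \<sigma>. hcoeff f \<alpha> * hcoeff g (\<sigma> - \<alpha>) * hcoeff h (\<gamma> - \<sigma>))"
    by (simp add: hcoeff_times sum_distrib_right)
  also have "\<dots> = (\<Sum>(\<sigma>,\<alpha>)\<in>Sigma ?T (?U f g). hcoeff f \<alpha> * hcoeff g (\<sigma> - \<alpha>) * hcoeff h (\<gamma> - \<sigma>))"
    by (rule sum.Sigma[OF fT]) (simp add: finite_times_index)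
  also have "\<dots> = (\<Sum>(\<alpha>,\<beta>)\<in>Sigma ?T' (\<lambda>\<alpha>. ?U g h (\<gamma> - \<alpha>)).
      hcoeff f \<alpha> * (hcoeff g \<beta> * hcoeff h (\<gamma> - \<alpha> - \<beta>)))"
  proof (rule sum.reindex_bij_witness[of _ "\<lambda>(\<alpha>,\<beta>). (\<alpha> + \<beta>, \<alpha>)" "\<lambda>(\<sigma>,\<alpha>). (\<alpha>, \<sigma> - \<alpha>)"], goal_cases)
    case (2 p)
    then obtain \<sigma> \<alpha> where p: "p = (\<sigma>, \<alpha>)" "hcoeff f \<alpha> \<noteq> 0" "hcoeff g (\<sigma> - \<alpha>) \<noteq> 0"
      "hcoeff h (\<gamma> - \<sigma>) \<noteq> 0" by auto
    have "\<gamma> - \<alpha> = (\<sigma> - \<alpha>) + (\<gamma> - \<sigma>)" by simp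
    then have "\<gamma> - \<alpha> \<in> ?sum g h" using p by blast
    then show ?case using p by simp
  next
    case (4 p)
    then obtain \<alpha> \<beta> where p: "p = (\<alpha>, \<beta>)" "hcoeff f \<alpha> \<noteq> 0" "hcoeff g \<beta> \<noteq> 0"
      "hcoeff h (\<gamma> - \<alpha> - \<beta>) \<noteq> 0" by auto
    have "\<alpha> + \<beta> \<in> ?sum f g" using p by blast
    then show ?case using p by (simp add: diff_diff_eq)
  qed (auto simp: algebra_simps)
  also have "\<dots> = (\<Sum>\<alpha>\<in>?T'. \<Sum>\<beta>\<in>?U g h (\<gamma> - \<alpha>).
      hcoeff f \<alpha> * (hcoeff g \<beta> * hcoeff h (\<gamma> - \<alpha> - \<beta>)))"
    by (rule sum.Sigma[OF fT', symmetric]) (simp add: finite_times_index)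
  also have "\<dots> = (\<Sum>\<alpha>\<in>?T'. hcoeff f \<alpha> * hcoeff (g * h) (\<gamma> - \<alpha>))"
    by (simp add: hcoeff_times sum_distrib_left)
  also have "\<dots> = hcoeff (f * (g * h)) \<gamma>"
    by (rule hcoeff_times'[OF fT', symmetric]) (use in_sum in blast)
  finally show "hcoeff ((f * g) * h) \<gamma> = hcoeff (f * (g * h)) \<gamma>" .
qed

instance
proof
  fix f g h :: "'a hahn"
  show "f * g * h = f * (g * h)" by (rule hahn_mult_assoc)
  show "f * g = g * f" by (rule hahn_mult_commute)
  show "(f + g) * h = f * h + g * h" by (rule hahn_distrib)
  show "1 * f = f"
    by (subst hahn_mult_commute) (rule hahn_eqI, simp add: one_hahn_def hcoeff_times_monom)
  have "hcoeff (0 :: 'a hahn) 0 \<noteq> hcoeff (1 :: 'a hahn) 0" by (simp add: hcoeff_one)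
  then show "(0 :: 'a hahn) \<noteq> 1" by metis
qed (rule hahn_eqI, simp)+

end

lemma hahn_least:
  fixes f :: "'g::linordered_ab_group_add hahn"
  assumes "f \<noteq> 0"
  obtains m where "hcoeff f m \<noteq> 0" "\<And>k. k < m \<Longrightarrow> hcoeff f k = 0"
proof -
  have "supp f \<noteq> {}" using assms hahn_eqI[of f 0] by auto
  then obtain m where "m \<in> supp f" "\<And>y. y \<in> supp f \<Longrightarrow> m \<le> y"
    by (rule wo_least[OF wfp_on_supp subset_refl]) blast
  then show ?thesis using that[of m] by (auto simp: not_less[symmetric])
qed

lemma hcoeff_times_leading:
  fixes f g :: "'g::linordered_ab_group_add hahn"
  assumes f: "\<And>k. k < a \<Longrightarrow> hcoeff f k = 0" and g: "\<And>k. k < b \<Longrightarrow> hcoeff g k = 0"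
  shows "hcoeff (f * g) (a + b) = hcoeff f a * hcoeff g b"
    and "k < a + b \<Longrightarrow> hcoeff (f * g) k = 0"
proof -
  have ge: "a \<le> \<alpha>" "b \<le> k - \<alpha>" if "hcoeff f \<alpha> \<noteq> 0 \<and> hcoeff g (k - \<alpha>) \<noteq> 0" for k \<alpha>
    using that f[of \<alpha>] g[of "k - \<alpha>"] by (auto simp: not_less[symmetric])
  have "hcoeff (f * g) (a + b) = (\<Sum>\<alpha>\<in>{a}. hcoeff f \<alpha> * hcoeff g (a + b - \<alpha>))"
  proof (rule hcoeff_times', simp, rule subsetI)
    fix \<alpha> assume "\<alpha> \<in> {\<alpha>. hcoeff f \<alpha> \<noteq> 0 \<and> hcoeff g (a + b - \<alpha>) \<noteq> 0}"
    with ge[of \<alpha> "a + b"] have "a \<le> \<alpha>" "b \<le> a + b - \<alpha>" by auto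
    then show "\<alpha> \<in> {a}" by (simp add: algebra_simps)
  qed
  then show "hcoeff (f * g) (a + b) = hcoeff f a * hcoeff g b" by simp
  show "hcoeff (f * g) k = 0" if k: "k < a + b"
  proof -
    have "\<not> (hcoeff f \<alpha> \<noteq> 0 \<and> hcoeff g (k - \<alpha>) \<noteq> 0)" for \<alpha>
    proof
      assume "hcoeff f \<alpha> \<noteq> 0 \<and> hcoeff g (k - \<alpha>) \<noteq> 0"
      from ge[OF this] have "a + b \<le> \<alpha> + (k - \<alpha>)" by (rule add_mono)
      with k show False by simp
    qed
    then have "hcoeff (f * g) k = (\<Sum>\<alpha>\<in>{}. hcoeff f \<alpha> * hcoeff g (k - \<alpha>))"
      by (intro hcoeff_times') auto
    then show ?thesis by simp
  qed
qed

subsection \<open>The order\<close>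

definition hahn_pos :: "'g::linorder hahn \<Rightarrow> bool" where
  "hahn_pos f \<longleftrightarrow> (\<exists>m. hcoeff f m > 0 \<and> (\<forall>k<m. hcoeff f k = 0))"

lemma hahn_pos_cases:
  fixes f :: "'g::linordered_ab_group_add hahn"
  assumes "f \<noteq> 0" shows "hahn_pos f \<or> hahn_pos (- f)"
proof -
  obtain m where "hcoeff f m \<noteq> 0" "\<And>k. k < m \<Longrightarrow> hcoeff f k = 0"
    using hahn_least[OF assms] by blast
  then show ?thesis unfolding hahn_pos_def by (cases "hcoeff f m > 0") (auto intro!: exI[of _ m])
qed

lemma hahn_pos_add:
  fixes f g :: "'g::linordered_ab_group_add hahn"
  assumes "hahn_pos f" "hahn_pos g" shows "hahn_pos (f + g)"
proof -
  obtain a b where a: "hcoeff f a > 0" "\<forall>k<a. hcoeff f k = 0"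
    and b: "hcoeff g b > 0" "\<forall>k<b. hcoeff g k = 0"
    using assms unfolding hahn_pos_def by blast
  have "hcoeff (f + g) (min a b) > 0"
    using a b by (cases a b rule: linorder_cases) (auto simp: min_def)
  moreover have "\<forall>k<min a b. hcoeff (f + g) k = 0" using a b by simp
  ultimately show ?thesis unfolding hahn_pos_def by blast
qed

lemma hahn_pos_mult:
  fixes f g :: "'g::linordered_ab_group_add hahn"
  assumes "hahn_pos f" "hahn_pos g" shows "hahn_pos (f * g)"
proof -
  obtain a b where a: "hcoeff f a > 0" "\<forall>k<a. hcoeff f k = 0"
    and b: "hcoeff g b > 0" "\<forall>k<b. hcoeff g k = 0"
    using assms unfolding hahn_pos_def by blast
  have "hcoeff (f * g) (a + b) > 0" "\<forall>k<a+b. hcoeff (f * g) k = 0"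
    using hcoeff_times_leading[of a f b g] a b by auto
  then show ?thesis unfolding hahn_pos_def by blast
qed

lemma hahn_not_pos_zero: "\<not> hahn_pos (0 :: 'g::linordered_ab_group_add hahn)"
  by (simp add: hahn_pos_def)

instantiation hahn :: (linordered_ab_group_add) linordered_idom
begin

definition less_hahn :: "'a hahn \<Rightarrow> 'a hahn \<Rightarrow> bool" where
  "(f :: 'a hahn) < g \<longleftrightarrow> hahn_pos (g - f)"

definition less_eq_hahn :: "'a hahn \<Rightarrow> 'a hahn \<Rightarrow> bool" where
  "(f :: 'a hahn) \<le> g \<longleftrightarrow> f = g \<or> hahn_pos (g - f)"

definition abs_hahn :: "'a hahn \<Rightarrow> 'a hahn" where
  "\<bar>f :: 'a hahn\<bar> = (if f < 0 then - f else f)"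

definition sgn_hahn :: "'a hahn \<Rightarrow> 'a hahn" where
  "sgn (f :: 'a hahn) = (if f = 0 then 0 else if 0 < f then 1 else - 1)"

instance
proof
  fix f g h :: "'a hahn"
  have asym: "\<not> hahn_pos (- p)" if "hahn_pos p" for p :: "'a hahn"
    using hahn_pos_add[OF that, of "- p"] hahn_not_pos_zero by auto
  show "(f < g) = (f \<le> g \<and> \<not> g \<le> f)"
    unfolding less_hahn_def less_eq_hahn_def
    using asym[of "g - f"] hahn_not_pos_zero by auto
  show "f \<le> f" by (simp add: less_eq_hahn_def)
  show "f \<le> h" if "f \<le> g" "g \<le> h"
    using that hahn_pos_add[of "g - f" "h - g"] unfolding less_eq_hahn_def by auto
  show "f = g" if "f \<le> g" "g \<le> f"
    using that asym[of "g - f"] unfolding less_eq_hahn_def by auto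
  show "f \<le> g \<or> g \<le> f"
    using hahn_pos_cases[of "g - f"] unfolding less_eq_hahn_def by auto
  show "h + f \<le> h + g" if "f \<le> g"
    using that unfolding less_eq_hahn_def by auto
  show "h * f < h * g" if "f < g" "0 < h"
    using that hahn_pos_mult[of h "g - f"] unfolding less_hahn_def by (simp add: right_diff_distrib)
  show "\<bar>f\<bar> = (if f < 0 then - f else f)" by (rule abs_hahn_def)
  show "sgn f = (if f = 0 then 0 else if 0 < f then 1 else - 1)" by (rule sgn_hahn_def)
qed

end

subsection \<open>Inverses\<close>

lemma hahn_unit_inverse:
  fixes f :: "'g::linordered_ab_group_add hahn"
  assumes f0: "hcoeff f 0 = 1" and fneg: "\<And>k. k < 0 \<Longrightarrow> hcoeff f k = 0"
  shows "\<exists>g. f * g = 1"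
proof -
  have agree: "hcoeff g k = hcoeff g' k"
    if eq: "\<forall>k\<le>s. hcoeff (f * g) k = hcoeff (f * g') k" and k: "k \<le> s" for g g' s k
  proof (rule ccontr)
    assume ne: "hcoeff g k \<noteq> hcoeff g' k"
    then have "g - g' \<noteq> 0" by auto
    then obtain b where b: "hcoeff (g - g') b \<noteq> 0" "\<And>k. k < b \<Longrightarrow> hcoeff (g - g') k = 0"
      using hahn_least by blast
    then have "b \<le> k" using ne by (metis hcoeff_minus linorder_not_less right_minus_eq)
    have "hcoeff (f * (g - g')) b = hcoeff (g - g') b"
      using hcoeff_times_leading(1)[of 0 f b "g - g'"] fneg b(2) f0 by simp
    moreover have "hcoeff (f * (g - g')) b = 0"
      using eq \<open>b \<le> k\<close> k by (simp add: right_diff_distrib)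
    ultimately show False using b(1) by simp
  qed
  have local: "hcoeff (f * g) k = hcoeff (f * g') k"
    if eq: "\<forall>k\<le>s. hcoeff g k = hcoeff g' k" and k: "k \<le> s" for g g' s k
  proof -
    have "hcoeff (f * (g - g')) k = (\<Sum>\<alpha>\<in>{}. hcoeff f \<alpha> * hcoeff (g - g') (k - \<alpha>))"
    proof (rule hcoeff_times', simp, rule subsetI)
      fix \<alpha> assume "\<alpha> \<in> {\<alpha>. hcoeff f \<alpha> \<noteq> 0 \<and> hcoeff (g - g') (k - \<alpha>) \<noteq> 0}"
      then have "0 \<le> \<alpha>" "hcoeff g (k - \<alpha>) \<noteq> hcoeff g' (k - \<alpha>)"
        using fneg[of \<alpha>] by (auto simp: not_less[symmetric])
      moreover from this have "k - \<alpha> \<le> s" using k by (simp add: diff_le_eq add_increasing2)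
      ultimately show "\<alpha> \<in> {}" using eq by simp
    qed
    then show ?thesis by (simp add: right_diff_distrib)
  qed
  define X where "X = {g. \<forall>s. hcoeff g s \<noteq> 0 \<longrightarrow> (\<forall>k\<le>s. hcoeff (f * g) k = hcoeff 1 k)}"
  define D where "D = {s. \<exists>g\<in>X. hcoeff g s \<noteq> 0}"
  define wit where "wit s = (SOME g. g \<in> X \<and> hcoeff g s \<noteq> 0)" for s
  define G where "G s = (if s \<in> D then hcoeff (wit s) s else 0)" for s
  have wit: "wit s \<in> X" "hcoeff (wit s) s \<noteq> 0" if "s \<in> D" for s
    using that someI_ex[of "\<lambda>g. g \<in> X \<and> hcoeff g s \<noteq> 0"] unfolding D_def wit_def by auto
  have G_eq: "G k = hcoeff g k" if g: "g \<in> X" "hcoeff g s \<noteq> 0" and k: "k \<le> s" for g s k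
  proof (cases "k \<in> D")
    case True
    have "hcoeff (wit k) k = hcoeff g k"
    proof (rule agree[of k])
      show "\<forall>j\<le>k. hcoeff (f * wit k) j = hcoeff (f * g) j"
        using wit[OF True] g k unfolding X_def by auto
    qed simp
    then show ?thesis using True by (simp add: G_def)
  next
    case False
    then show ?thesis using g(1) by (auto simp: G_def D_def)
  qed
  have D_iff: "G s \<noteq> 0 \<longleftrightarrow> s \<in> D" for s using wit by (auto simp: G_def)
  have "wfp_on {s. G s \<noteq> 0} (<)"
  proof (rule woI)
    fix S assume S: "S \<subseteq> {s. G s \<noteq> 0}" "S \<noteq> {}"
    then obtain s where s: "s \<in> S" by blast
    then have sD: "s \<in> D" using S D_iff by blast
    have "{k\<in>S. k \<le> s} \<subseteq> supp (wit s)"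
      using S(1) G_eq[OF wit[OF sD]] by auto
    moreover have "{k\<in>S. k \<le> s} \<noteq> {}" using s by blast
    ultimately obtain z where z: "z \<in> {k\<in>S. k \<le> s}" "\<And>y. y \<in> {k\<in>S. k \<le> s} \<Longrightarrow> z \<le> y"
      by (rule wo_least[OF wfp_on_supp]) blast
    have "z \<le> y" if "y \<in> S" for y
      using z that by (cases "y \<le> s") auto
    then show "\<exists>z\<in>S. \<forall>y\<in>S. z \<le> y" using z(1) by blast
  qed
  then have GA: "hcoeff (Abs_hahn G) = G" by (simp add: Abs_hahn_inverse)
  let ?g = "Abs_hahn G"
  have gX: "hcoeff (f * ?g) k = hcoeff 1 k" if "hcoeff ?g s \<noteq> 0" "k \<le> s" for s k
  proof -
    have sD: "s \<in> D" using that(1) D_iff GA by simp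
    have "hcoeff (f * ?g) k = hcoeff (f * wit s) k"
      by (rule local[OF _ that(2)]) (simp add: GA G_eq[OF wit[OF sD]])
    also have "\<dots> = hcoeff 1 k" using wit[OF sD] that(2) unfolding X_def by auto
    finally show ?thesis .
  qed
  have "f * ?g = 1"
  proof (rule ccontr)
    assume "f * ?g \<noteq> 1"
    then have "1 - f * ?g \<noteq> 0" by auto
    then obtain d where d: "hcoeff (1 - f * ?g) d \<noteq> 0" "\<And>k. k < d \<Longrightarrow> hcoeff (1 - f * ?g) k = 0"
      using hahn_least by blast
    define c where "c = hcoeff (1 - f * ?g) d"
    define g' where "g' = ?g + hahn_monom d c"
    have sd: "s < d" if "hcoeff ?g s \<noteq> 0" for s
      using gX[OF that] d(1) by (metis hcoeff_minus linorder_not_less right_minus_eq)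
    have mon: "hcoeff (f * hahn_monom d c) k = (if k < d then 0 else if k = d then c else hcoeff (f * hahn_monom d c) k)" for k
      by (auto simp: hcoeff_times_monom f0 fneg)
    have g'1: "hcoeff (f * g') k = hcoeff 1 k" if "k \<le> d" for k
    proof (cases "k = d")
      case True
      then show ?thesis using mon[of k] by (simp add: g'_def distrib_left c_def)
    next
      case False
      with that have "k < d" by simp
      then have "hcoeff (f * hahn_monom d c) k = 0" using mon[of k] by presburger
      then show ?thesis using \<open>k < d\<close> d(2)[of k] by (simp add: g'_def distrib_left)
    qed
    have "g' \<in> X"
      unfolding X_def
    proof (intro CollectI allI impI)
      fix s k assume s: "hcoeff g' s \<noteq> 0" and k: "k \<le> s"
      from s have "s \<le> d" using sd[of s] by (auto simp: g'_def hcoeff_monom split: if_splits)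
      then show "hcoeff (f * g') k = hcoeff 1 k" using g'1 k by simp
    qed
    moreover have g0: "hcoeff ?g d = 0" using sd[of d] by auto
    moreover have "hcoeff g' d \<noteq> 0" using g0 d(1) by (simp add: g'_def hcoeff_monom c_def)
    ultimately have "d \<in> D" unfolding D_def by blast
    then show False using g0 D_iff[of d] GA by simp
  qed
  then show ?thesis by blast
qed

lemma hahn_inverse_exists:
  fixes f :: "'g::linordered_ab_group_add hahn"
  assumes "f \<noteq> 0"
  shows "\<exists>g. f * g = 1"
proof -
  obtain m where m: "hcoeff f m \<noteq> 0" "\<And>k. k < m \<Longrightarrow> hcoeff f k = 0"
    using hahn_least[OF assms] by blast
  let ?u = "hahn_monom (- m) (1 / hcoeff f m)"
  have "\<exists>g. f * ?u * g = 1"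
    using m by (intro hahn_unit_inverse) (auto simp: hcoeff_times_monom)
  then show ?thesis by (metis mult.assoc)
qed

instantiation hahn :: (linordered_ab_group_add) linordered_field
begin

definition inverse_hahn :: "'a hahn \<Rightarrow> 'a hahn" where
  "inverse (f :: 'a hahn) = (if f = 0 then 0 else THE g. f * g = 1)"

definition divide_hahn :: "'a hahn \<Rightarrow> 'a hahn \<Rightarrow> 'a hahn" where
  "(f :: 'a hahn) div g = f * inverse g"

instance
proof
  fix f g :: "'a hahn"
  show "inverse f * f = 1" if "f \<noteq> 0"
  proof -
    have "\<exists>!g. f * g = 1"
      using hahn_inverse_exists[OF that] by (metis mult.commute mult.left_commute mult_1_right)
    from theI'[OF this] show ?thesis using that by (simp add: inverse_hahn_def mult.commute)
  qed
  show "f div g = f * inverse g" by (rule divide_hahn_def)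
  show "inverse (0 :: 'a hahn) = 0" by (simp add: inverse_hahn_def)
qed

end

abbreviation tpow :: "'g::linorder \<Rightarrow> 'g hahn" where
  "tpow m \<equiv> hahn_monom m 1"

section \<open>Comparison of matrices\<close>

text \<open>Matrices with \<open>n\<close> columns and an arbitrary positive number of rows.\<close>

definition mats_cols :: "nat \<Rightarrow> 'a mat set" where
  "mats_cols n = (\<Union>m\<in>{1..}. carrier_mat m n)"

definition psd_le :: "nat \<Rightarrow> 'a::linordered_idom mat \<Rightarrow> 'a mat \<Rightarrow> bool" where
  "psd_le n S T \<longleftrightarrow>
     S \<in> carrier_mat n n \<and> S\<^sup>T = S \<and> T \<in> carrier_mat n n \<and> T\<^sup>T = T \<and>
     (\<forall>v\<in>carrier_vec n. 0 \<le> v \<bullet> ((T - S) *\<^sub>v v))"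

text \<open>The relation \<open>A \<succeq>\<^sub>n B\<close>; note that it bounds the Gram matrix of \<open>A\<close> by that of \<open>B\<close>.\<close>

definition arch_ge :: "nat \<Rightarrow> 'a::linordered_idom mat \<Rightarrow> 'a mat \<Rightarrow> bool" where
  "arch_ge n A B \<longleftrightarrow> (\<exists>r::nat. psd_le n (A\<^sup>T * A) (of_nat r \<cdot>\<^sub>m (B\<^sup>T * B)))"

definition arch_equiv :: "nat \<Rightarrow> 'a::linordered_idom mat \<Rightarrow> 'a mat \<Rightarrow> bool" where
  "arch_equiv n A B \<longleftrightarrow> arch_ge n A B \<and> arch_ge n B A"

section \<open>Row echelon forms and archimedean canonical forms\<close>

text \<open>Rows and columns are numbered from \<open>0\<close>.\<close>

definition zero_row :: "'a::zero mat \<Rightarrow> nat \<Rightarrow> bool" where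
  "zero_row C i \<longleftrightarrow> (\<forall>j<dim_col C. C $$ (i, j) = 0)"

text \<open>The column of the first nonzero element of row \<open>i\<close>; meaningful only if that row is nonzero.\<close>

definition pivot_col :: "'a::zero mat \<Rightarrow> nat \<Rightarrow> nat" where
  "pivot_col C i = (LEAST j. j < dim_col C \<and> C $$ (i, j) \<noteq> 0)"

text \<open>Once the zero rows are at the bottom, the \<open>i\<close>-th nonzero row is row \<open>i\<close>.\<close>

definition is_row_echelon :: "'a::zero mat \<Rightarrow> bool" where
  "is_row_echelon C \<longleftrightarrow>
     (\<forall>i j. i < j \<and> j < dim_row C \<and> zero_row C i \<longrightarrow> zero_row C j) \<and>
     (\<forall>i. Suc i < dim_row C \<and> \<not> zero_row C i \<and> \<not> zero_row C (Suc i) \<longrightarrow>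
        pivot_col C i < pivot_col C (Suc i))"

definition archimedean_canonical_form :: "'g::linordered_ab_group_add hahn mat \<Rightarrow> bool" where
  "archimedean_canonical_form C \<longleftrightarrow>
     is_row_echelon C \<and>
     (\<forall>i<dim_row C. \<not> zero_row C i) \<and>
     (\<exists>m :: nat \<Rightarrow> 'g. \<forall>i<dim_row C.
        C $$ (i, pivot_col C i) = tpow (m i) \<and>
        (\<forall>j<i. \<forall>\<gamma>\<ge>m i. hcoeff (C $$ (j, pivot_col C i)) \<gamma> = 0))"

end

theory Submission
  imports Defs
begin

text \<open>
  Let \<open>O\<close> be the valuation ring of the field of series: the series without negative exponents. Two
  observations reduce the theorem to the Hermite normal form over \<open>O\<close>.

  First, an element \<open>x\<close> lies in \<open>O\<close> iff its square is bounded by a natural number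
  (\<open>exps_ge_0_if_square_le\<close>, \<open>square_le_if_exps_ge_0\<close>). So \<open>O\<close> consists of the elements that are not
  infinitely large, and \<open>arch_ge\<close>, which bounds \<open>\<bar>A v\<bar>\<^sup>2\<close> by a natural multiple of
  \<open>\<bar>C v\<bar>\<^sup>2\<close> for all \<open>v\<close>, should mean that \<open>A = X C\<close> for a matrix \<open>X\<close> over \<open>O\<close>. If
  such an \<open>X\<close> exists, the bound follows by expanding squares (\<open>ospan_imp_arch_ge\<close>). Conversely, if
  \<open>C\<close> is in echelon form without zero rows, then \<open>C\<close> is surjective as a linear map; testing the
  bound on vectors that \<open>C\<close> maps to the unit vectors gives \<open>X\<close> and bounds its entries
  (\<open>arch_ge_imp_ospan\<close>). Hence a canonical form is equivalent to \<open>A\<close> iff its rows span the same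
  \<open>O\<close>-module as the rows of \<open>A\<close>.

  Secondly, every \<open>O\<close>-module spanned by finitely many vectors is spanned by the rows of exactly one
  archimedean canonical form. For existence (\<open>reduced_family_exists\<close>), columns are cleared one at a
  time: an entry of largest absolute value divides the others with quotients in \<open>O\<close>, it can be scaled
  by a unit of \<open>O\<close> to a power of \<open>t\<close>, and the new row is then reduced against the later pivots by
  splitting each entry at the exponent of the pivot. For uniqueness (\<open>reduced_family_unique\<close>), the
  leading entry of any nonzero vector of the module sits in a pivot column \<open>k\<close> and has all its exponents
  at least the exponent \<open>m\<close> of that pivot (\<open>leading_entry_ospan\<close>). This determines the pivots; and
  the difference of two rows with the same pivot would lead in some column \<open>k\<close> with an entry whose
  exponents are \<open>< m\<close>, because both rows are reduced, and \<open>\<ge> m\<close>, because it lies in the module.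
\<close>

section \<open>Series with exponents bounded below\<close>

definition exps_ge :: "'g::linorder \<Rightarrow> 'g hahn \<Rightarrow> bool" where
  "exps_ge m x \<longleftrightarrow> (\<forall>\<gamma><m. hcoeff x \<gamma> = 0)"

lemma exps_ge_zero [simp]: "exps_ge m (0 :: 'g::linordered_ab_group_add hahn)"
  by (simp add: exps_ge_def)

lemma exps_ge_one [simp]: "exps_ge 0 (1 :: 'g::linordered_ab_group_add hahn)"
  by (simp add: exps_ge_def hcoeff_one)

lemma exps_ge_tpow [simp]: "exps_ge m (tpow m)"
  by (simp add: exps_ge_def hcoeff_monom)

lemma exps_ge_add:
  fixes x y :: "'g::linordered_ab_group_add hahn"
  shows "exps_ge m x \<Longrightarrow> exps_ge m y \<Longrightarrow> exps_ge m (x + y)"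
  by (simp add: exps_ge_def)

lemma exps_ge_uminus [simp]:
  fixes x :: "'g::linordered_ab_group_add hahn"
  shows "exps_ge m (- x) \<longleftrightarrow> exps_ge m x"
  by (simp add: exps_ge_def)

lemma exps_ge_mult:
  fixes x y :: "'g::linordered_ab_group_add hahn"
  assumes "exps_ge a x" "exps_ge b y"
  shows "exps_ge (a + b) (x * y)"
  using assms hcoeff_times_leading(2)[of a x b y] by (auto simp: exps_ge_def)

lemma exps_ge_mult_0:
  fixes x y :: "'g::linordered_ab_group_add hahn"
  shows "exps_ge 0 x \<Longrightarrow> exps_ge 0 y \<Longrightarrow> exps_ge 0 (x * y)"
  using exps_ge_mult[of 0 x 0 y] by simp

lemma tpow_nonzero [simp]: "tpow m \<noteq> (0 :: 'g::linordered_ab_group_add hahn)"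
proof
  assume "tpow m = 0"
  then have "hcoeff (tpow m) m = 0" by simp
  then show False by (simp add: hcoeff_monom)
qed

lemma tpow_mult: "tpow a * tpow b = (tpow (a + b) :: 'g::linordered_ab_group_add hahn)"
  by (rule hahn_eqI) (auto simp: hcoeff_times_monom hcoeff_monom algebra_simps)

lemma inverse_tpow: "inverse (tpow m) = (tpow (- m) :: 'g::linordered_ab_group_add hahn)"
  by (rule inverse_unique) (simp add: tpow_mult one_hahn_def)

lemma exps_ge_divide_tpow:
  fixes x :: "'g::linordered_ab_group_add hahn"
  assumes "exps_ge m x"
  shows "exps_ge 0 (x / tpow m)"
  using exps_ge_mult[OF assms exps_ge_tpow[of "- m"]] by (simp add: divide_inverse inverse_tpow)

text \<open>The leading exponents of a series and its inverse add up to the leading exponent \<open>0\<close> of their product.\<close>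

lemma exps_ge_inverse:
  fixes x :: "'g::linordered_ab_group_add hahn"
  assumes "hcoeff x m \<noteq> 0" "exps_ge m x"
  shows "exps_ge (- m) (inverse x)"
proof -
  have x: "x \<noteq> 0" using assms(1) by auto
  then obtain l where l: "hcoeff (inverse x) l \<noteq> 0" "\<And>\<gamma>. \<gamma> < l \<Longrightarrow> hcoeff (inverse x) \<gamma> = 0"
    using hahn_least[of "inverse x"] by auto
  have "hcoeff (x * inverse x) (m + l) \<noteq> 0"
    using hcoeff_times_leading(1)[of m x l "inverse x"] assms l by (auto simp: exps_ge_def)
  then have "m + l = 0" using x by (auto simp: hcoeff_one split: if_splits)
  then have "l = - m" by (simp add: eq_neg_iff_add_eq_0 add.commute)
  with l show ?thesis by (simp add: exps_ge_def)
qed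

lemma hcoeff_of_nat:
  "hcoeff (of_nat r :: 'g::linordered_ab_group_add hahn) \<gamma> = (if \<gamma> = 0 then of_nat r else 0)"
  by (induction r) (simp_all add: hcoeff_one)

text \<open>If \<open>x\<close> led with an exponent \<open>l < 0\<close>, its square would lead with a positive coefficient at
  \<open>2l < 0\<close> and so exceed every natural number.\<close>

lemma exps_ge_0_if_square_le:
  fixes x :: "'g::linordered_ab_group_add hahn"
  assumes "x\<^sup>2 \<le> of_nat r"
  shows "exps_ge 0 x"
proof (cases "x = 0")
  case False
  then obtain l where l: "hcoeff x l \<noteq> 0" "\<And>\<gamma>. \<gamma> < l \<Longrightarrow> hcoeff x \<gamma> = 0"
    using hahn_least by blast
  have "\<not> l < 0"
  proof
    assume neg: "l < 0"
    then have ll: "l + l < 0" by (simp add: add_neg_neg)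
    have "hcoeff (x\<^sup>2 - of_nat r) (l + l) > 0"
      using hcoeff_times_leading(1)[of l x l x] l ll
      by (auto simp: power2_eq_square hcoeff_of_nat zero_less_mult_iff linorder_neq_iff)
    moreover have "\<forall>k<l + l. hcoeff (x\<^sup>2 - of_nat r) k = 0"
      using hcoeff_times_leading(2)[of l x l x] l ll
      by (auto simp: power2_eq_square hcoeff_of_nat)
    ultimately have "of_nat r < x\<^sup>2" unfolding less_hahn_def hahn_pos_def by blast
    with assms show False by simp
  qed
  then show ?thesis using l by (simp add: exps_ge_def)
qed simp

text \<open>It suffices that \<open>r\<close> exceeds the constant coefficient of \<open>x\<^sup>2\<close>: then \<open>r - x\<^sup>2\<close> leads with a positive
  constant term. The real numbers enter here through the Archimedean property.\<close>

lemma square_le_if_exps_ge_0: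
  fixes x :: "'g::linordered_ab_group_add hahn"
  assumes "exps_ge 0 x"
  obtains r :: nat where "x\<^sup>2 \<le> of_nat r"
proof -
  have x2: "exps_ge 0 (x\<^sup>2)" using exps_ge_mult_0[OF assms assms] by (simp add: power2_eq_square)
  obtain r :: nat where "hcoeff (x\<^sup>2) 0 < of_nat r" using reals_Archimedean2 by blast
  then have "hahn_pos (of_nat r - x\<^sup>2)"
    using x2 unfolding hahn_pos_def by (intro exI[of _ 0]) (simp add: exps_ge_def hcoeff_of_nat)
  then have "x\<^sup>2 \<le> of_nat r" by (simp add: less_eq_hahn_def)
  then show ?thesis using that by blast
qed

lemma split_at_exponent:
  fixes x :: "'g::linordered_ab_group_add hahn"
  obtains y where "exps_ge m y" "\<And>\<gamma>. \<gamma> \<ge> m \<Longrightarrow> hcoeff (x - y) \<gamma> = 0"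
proof -
  let ?f = "\<lambda>\<gamma>. if \<gamma> < m then 0 else hcoeff x \<gamma>"
  have "wfp_on {\<gamma>. ?f \<gamma> \<noteq> 0} (<)"
    by (rule wfp_on_subset[OF wfp_on_supp[of x]]) auto
  then have *: "hcoeff (Abs_hahn ?f) = ?f" by (simp add: Abs_hahn_inverse)
  show ?thesis by (rule that[of "Abs_hahn ?f"]) (auto simp: exps_ge_def *)
qed

section \<open>Spans over the valuation ring\<close>

text \<open>Vectors are functions on all of \<open>nat\<close>; those that come from matrices vanish beyond the last column.
  The letter \<open>o\<close> stands for the valuation ring.\<close>

definition ospan :: "'i set \<Rightarrow> ('i \<Rightarrow> nat \<Rightarrow> 'g::linordered_ab_group_add hahn) \<Rightarrow> (nat \<Rightarrow> 'g hahn) set"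
  where "ospan I w = {u. \<exists>x. (\<forall>i\<in>I. exps_ge 0 (x i)) \<and> u = (\<lambda>j. \<Sum>i\<in>I. x i * w i j)}"

lemma ospan_zero: "(\<lambda>_. 0) \<in> ospan I w"
  unfolding ospan_def by (auto intro!: exI[of _ "\<lambda>_. 0"])

lemma ospan_add:
  assumes "u \<in> ospan I w" "v \<in> ospan I w"
  shows "(\<lambda>j. u j + v j) \<in> ospan I w"
proof -
  obtain x y where x: "\<forall>i\<in>I. exps_ge 0 (x i)" "u = (\<lambda>j. \<Sum>i\<in>I. x i * w i j)"
    and y: "\<forall>i\<in>I. exps_ge 0 (y i)" "v = (\<lambda>j. \<Sum>i\<in>I. y i * w i j)"
    using assms unfolding ospan_def by blast
  show ?thesis unfolding ospan_def using x y
    by (auto intro!: exI[of _ "\<lambda>i. x i + y i"] exps_ge_add simp: distrib_right sum.distrib)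
qed

lemma ospan_smult:
  assumes "u \<in> ospan I w" "exps_ge 0 c"
  shows "(\<lambda>j. c * u j) \<in> ospan I w"
proof -
  obtain x where x: "\<forall>i\<in>I. exps_ge 0 (x i)" "u = (\<lambda>j. \<Sum>i\<in>I. x i * w i j)"
    using assms unfolding ospan_def by blast
  show ?thesis unfolding ospan_def using x assms(2)
    by (auto intro!: exI[of _ "\<lambda>i. c * x i"] exps_ge_mult_0 simp: sum_distrib_left mult.assoc)
qed

lemma ospan_diff:
  assumes "u \<in> ospan I w" "v \<in> ospan I w"
  shows "(\<lambda>j. u j - v j) \<in> ospan I w"
  using ospan_add[OF assms(1) ospan_smult[OF assms(2), of "- 1"]] by simp

lemma ospan_base:
  assumes "finite I" "i \<in> I"
  shows "w i \<in> ospan I w"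
  unfolding ospan_def using assms
  by (auto intro!: exI[of _ "\<lambda>l. if l = i then 1 else 0"] simp: if_distrib[of "\<lambda>c. c * _"] cong: if_cong)

lemma ospan_vanishes_at:
  assumes "u \<in> ospan I w" "\<And>i. i \<in> I \<Longrightarrow> w i j = 0"
  shows "u j = 0"
  using assms unfolding ospan_def by auto

lemma ospan_mono:
  assumes "\<And>i. i \<in> I \<Longrightarrow> w i \<in> ospan J v"
  shows "ospan I w \<subseteq> ospan J v"
proof
  fix u assume "u \<in> ospan I w"
  then obtain x where x: "\<forall>i\<in>I. exps_ge 0 (x i)" "u = (\<lambda>j. \<Sum>i\<in>I. x i * w i j)"
    unfolding ospan_def by blast
  have "(\<lambda>j. \<Sum>i\<in>I'. x i * w i j) \<in> ospan J v" if "I' \<subseteq> I" for I'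
    using that
  proof (induction I' rule: infinite_finite_induct)
    case (insert i I')
    then show ?case using ospan_add[OF ospan_smult[of "w i" J v "x i"] insert.IH] assms x(1) by simp
  qed (simp_all add: ospan_zero)
  then show "u \<in> ospan J v" using x(2) by blast
qed

section \<open>Echelon families and reduced families\<close>

text \<open>An echelon matrix as a family of rows, with \<open>k i\<close> the pivot column of row \<open>i\<close> and \<open>t\<close> to the
  \<open>m i\<close> its pivot. The index set need not be an interval of numbers: the existence proof indexes rows by
  their pivot columns, while matrices index them by position.\<close>

definition echelon_family ::
  "'i set \<Rightarrow> ('i \<Rightarrow> nat) \<Rightarrow> ('i \<Rightarrow> 'g) \<Rightarrow> ('i \<Rightarrow> nat \<Rightarrow> 'g::linordered_ab_group_add hahn) \<Rightarrow> bool"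
  where "echelon_family I k m w \<longleftrightarrow> finite I \<and> inj_on k I \<and>
    (\<forall>i\<in>I. (\<forall>j<k i. w i j = 0) \<and> w i (k i) = tpow (m i))"

definition exps_less :: "'g \<Rightarrow> 'g::linorder hahn \<Rightarrow> bool" where
  "exps_less m x \<longleftrightarrow> (\<forall>\<gamma>\<ge>m. hcoeff x \<gamma> = 0)"

definition reduced_family ::
  "'i set \<Rightarrow> ('i \<Rightarrow> nat) \<Rightarrow> ('i \<Rightarrow> 'g) \<Rightarrow> ('i \<Rightarrow> nat \<Rightarrow> 'g::linordered_ab_group_add hahn) \<Rightarrow> bool"
  where "reduced_family I k m w \<longleftrightarrow> echelon_family I k m w \<and>
    (\<forall>i\<in>I. \<forall>l\<in>I. k i < k l \<longrightarrow> exps_less (m l) (w i (k l)))"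

lemma echelon_familyD:
  assumes "echelon_family I k m w"
  shows "finite I" "inj_on k I" "i \<in> I \<Longrightarrow> j < k i \<Longrightarrow> w i j = 0" "i \<in> I \<Longrightarrow> w i (k i) = tpow (m i)"
  using assms unfolding echelon_family_def by auto

text \<open>Among the rows that occur in \<open>u\<close> with a nonzero coefficient, the one with the leftmost pivot alone
  contributes to the leading entry, which is therefore an \<open>O\<close>-multiple of that pivot.\<close>

lemma leading_entry_ospan:
  assumes ech: "echelon_family I k m w" and u: "u \<in> ospan I w" and nz: "u j0 \<noteq> 0"
  obtains i where "i \<in> I" "\<And>j. j < k i \<Longrightarrow> u j = 0" "u (k i) \<noteq> 0" "exps_ge (m i) (u (k i))"
proof -
  note E = echelon_familyD[OF ech]
  obtain x where x: "\<forall>i\<in>I. exps_ge 0 (x i)" "u = (\<lambda>j. \<Sum>i\<in>I. x i * w i j)"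
    using u unfolding ospan_def by blast
  define J where "J = {i\<in>I. x i \<noteq> 0}"
  have "J \<noteq> {}"
  proof
    assume "J = {}"
    then have "u j0 = 0" unfolding x(2) J_def by (auto intro!: sum.neutral)
    with nz show False by simp
  qed
  then obtain i where i: "i \<in> J" "\<And>l. l \<in> J \<Longrightarrow> k i \<le> k l"
    using ex_has_least_nat[of "\<lambda>i. i \<in> J" _ k] by blast
  then have iI: "i \<in> I" "x i \<noteq> 0" by (auto simp: J_def)
  have later: "x l = 0 \<or> k i < k l" if "l \<in> I" "l \<noteq> i" for l
    using i(2)[of l] that iI E(2) by (force simp: J_def inj_on_def)
  have "u j = 0" if "j < k i" for j
    unfolding x(2)
  proof (rule sum.neutral, intro ballI)
    fix l assume "l \<in> I"
    then show "x l * w l j = 0" using later[of l] E(3)[of l j] that by (cases "l = i") auto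
  qed
  moreover have "u (k i) = x i * tpow (m i)"
  proof -
    have "u (k i) = (\<Sum>l\<in>{i}. x l * w l (k i))"
      unfolding x(2)
    proof (rule sum.mono_neutral_right)
      show "\<forall>l\<in>I - {i}. x l * w l (k i) = 0"
        using later E(3) by fastforce
    qed (use iI E in auto)
    then show ?thesis using E(4)[OF iI(1)] by simp
  qed
  moreover have "exps_ge (m i) (x i * tpow (m i))"
    using exps_ge_mult[of 0 "x i" "m i" "tpow (m i)"] x(1) iI by simp
  ultimately show ?thesis using that[OF iI(1)] iI by simp
qed

lemma reduced_family_pivots_le:
  assumes C: "reduced_family I k m w" and D: "reduced_family J l q v"
    and sub: "ospan I w \<subseteq> ospan J v" and i: "i \<in> I"
  shows "\<exists>j\<in>J. l j = k i \<and> q j \<le> m i"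
proof -
  have EC: "echelon_family I k m w" and ED: "echelon_family J l q v"
    using C D by (auto simp: reduced_family_def)
  note E = echelon_familyD[OF EC]
  have wk: "w i (k i) \<noteq> 0" using E(4)[OF i] by simp
  have "w i \<in> ospan J v" using ospan_base[OF E(1) i] sub by blast
  then obtain j where j: "j \<in> J" "\<And>c. c < l j \<Longrightarrow> w i c = 0" "w i (l j) \<noteq> 0" "exps_ge (q j) (w i (l j))"
    using leading_entry_ospan[of J l q v "w i" "k i", OF ED _ wk] by metis
  have lk: "l j = k i"
    using j(2)[of "k i"] j(3) wk E(3)[OF i, of "l j"] by (meson linorder_neqE_nat)
  have "\<not> m i < q j" using j(4) lk E(4)[OF i] by (auto simp: exps_ge_def hcoeff_monom)
  with j lk show ?thesis by auto
qed

text \<open>Containment both ways gives equal pivots. The difference of corresponding rows again lies in the span,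
  so \<open>leading_entry_ospan\<close> bounds the exponents of its leading entry from below; reducedness bounds them
  from above.\<close>

lemma reduced_family_unique:
  assumes C: "reduced_family I k m w" and D: "reduced_family J l q v"
    and eq: "ospan I w = ospan J v"
  shows "k ` I = l ` J"
    and "i \<in> I \<Longrightarrow> j \<in> J \<Longrightarrow> k i = l j \<Longrightarrow> w i = v j"
proof -
  have EC: "echelon_family I k m w" and ED: "echelon_family J l q v"
    using C D by (auto simp: reduced_family_def)
  note E = echelon_familyD[OF EC] and E' = echelon_familyD[OF ED]
  have le: "\<exists>j\<in>J. l j = k i \<and> q j \<le> m i" if "i \<in> I" for i
    using reduced_family_pivots_le[OF C D _ that] eq by blast
  have ge: "\<exists>i\<in>I. k i = l j \<and> m i \<le> q j" if "j \<in> J" for j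
    using reduced_family_pivots_le[OF D C _ that] eq by blast
  show "k ` I = l ` J" using le ge by (auto simp: image_iff) metis+
  have mq: "m i = q j" if "i \<in> I" "j \<in> J" "k i = l j" for i j
    using le[OF that(1)] ge[OF that(2)] that E(2) E'(2) by (metis inj_on_def order_antisym)
  show "w i = v j" if ij: "i \<in> I" "j \<in> J" "k i = l j"
  proof (rule ccontr)
    assume "w i \<noteq> v j"
    then obtain c where c: "w i c - v j c \<noteq> 0" by auto
    let ?d = "\<lambda>c. w i c - v j c"
    have "?d \<in> ospan I w"
      using ospan_diff[OF ospan_base[OF E(1) ij(1)]] ospan_base[OF E'(1) ij(2)] eq by blast
    \<comment> \<open>Column \<open>k p\<close> is a pivot column of both families, with the same pivot.\<close>
    from leading_entry_ospan[OF EC this c] obtain p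
      where p: "p \<in> I" "\<And>c. c < k p \<Longrightarrow> ?d c = 0" "?d (k p) \<noteq> 0" "exps_ge (m p) (?d (k p))"
      by metis
    have "?d a = 0" if "a \<le> k i" for a
      using that E(3,4)[OF ij(1)] E'(3,4)[OF ij(2)] ij(3) mq[OF ij] by (cases "a = k i") auto
    then have less: "k i < k p" using p(3) by (meson linorder_not_le)
    obtain p' where p': "p' \<in> J" "k p = l p'" using le[OF p(1)] by metis
    have "exps_less (m p) (w i (k p))"
      using C ij(1) p(1) less by (auto simp: reduced_family_def)
    moreover have "exps_less (m p) (v j (k p))"
      using D ij p' less mq[OF p(1) p'] by (auto simp: reduced_family_def)
    ultimately have "hcoeff (?d (k p)) \<gamma> = 0" for \<gamma>
      using p(4) by (cases "\<gamma> < m p") (auto simp: exps_less_def exps_ge_def)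
    then have "?d (k p) = 0" by (intro hahn_eqI) (simp del: hcoeff_minus)
    with p(3) show False by simp
  qed
qed

section \<open>Existence of a reduced family with a given span\<close>

text \<open>The pivot columns are treated from left to right, since subtracting a multiple of row \<open>b\<close> leaves the
  columns before \<open>b\<close> untouched. The part of the entry with exponents at least \<open>m b\<close> is an
  \<open>O\<close>-multiple of the pivot and can be removed.\<close>

lemma reduce_against_family:
  assumes red: "reduced_family P id m w"
  obtains u where "(\<lambda>j. u j - s j) \<in> ospan P w" "\<And>p. p \<in> P \<Longrightarrow> exps_less (m p) (u p)"
proof -
  have ech: "echelon_family P id m w" using red by (simp add: reduced_family_def)
  note E = echelon_familyD[OF ech]
  have ex: "\<exists>u. (\<lambda>j. u j - s j) \<in> ospan P w \<and> (\<forall>p\<in>P. p < b \<longrightarrow> exps_less (m p) (u p))" for b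
  proof (induction b)
    case 0
    show ?case by (rule exI[of _ s]) (simp add: ospan_zero)
  next
    case (Suc b)
    then obtain u where u: "(\<lambda>j. u j - s j) \<in> ospan P w" "\<forall>p\<in>P. p < b \<longrightarrow> exps_less (m p) (u p)"
      by blast
    show ?case
    proof (cases "b \<in> P")
      case False
      then show ?thesis using u by (auto simp: less_Suc_eq)
    next
      case True
      obtain y where y: "exps_ge (m b) y" "\<And>\<gamma>. \<gamma> \<ge> m b \<Longrightarrow> hcoeff (u b - y) \<gamma> = 0"
        using split_at_exponent by blast
      let ?c = "y / tpow (m b)"
      let ?u = "\<lambda>j. u j - ?c * w b j"
      have "(\<lambda>j. ?u j - s j) \<in> ospan P w"
        using ospan_diff[OF u(1) ospan_smult[OF ospan_base[OF E(1) True] exps_ge_divide_tpow[OF y(1)]]]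
        by (simp add: algebra_simps)
      moreover have "?u b = u b - y" using E(4)[OF True] by simp
      then have "exps_less (m b) (?u b)" using y(2) by (simp add: exps_less_def)
      moreover have "exps_less (m p) (?u p)" if "p \<in> P" "p < b" for p
      proof -
        have "?u p = u p" using E(3)[OF True, of p] that by simp
        with u(2) that show ?thesis by metis
      qed
      ultimately show ?thesis by (intro exI[of _ ?u]) (metis less_Suc_eq)
    qed
  qed
  obtain b where b: "\<forall>p\<in>P. p < b"
    using E(1) unfolding finite_nat_set_iff_bounded by (elim exE)
  obtain u where u: "(\<lambda>j. u j - s j) \<in> ospan P w" "\<forall>p\<in>P. p < b \<longrightarrow> exps_less (m p) (u p)"
    using ex[of b] by (elim exE conjE)
  show ?thesis by (rule that[OF u(1)]) (use u(2) b in simp)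
qed

text \<open>Gaussian elimination over \<open>O\<close>, by induction on the number of columns that are already zero, starting
  from the zero family. The eliminated row is kept in the family as a zero row, so that the index set stays
  fixed.\<close>

lemma reduced_family_exists:
  fixes s :: "'i \<Rightarrow> nat \<Rightarrow> 'g::linordered_ab_group_add hahn"
  assumes "finite I" "\<And>i j. i \<in> I \<Longrightarrow> n \<le> j \<Longrightarrow> s i j = 0"
  obtains P m w where "P \<subseteq> {..<n}" "reduced_family P id m w" "ospan P w = ospan I s"
proof -
  have "\<exists>P m w. P \<subseteq> {k..<n} \<and> reduced_family P id m w \<and> ospan P w = ospan I s"
    if "k \<le> n" "\<forall>i\<in>I. \<forall>j. j < k \<or> n \<le> j \<longrightarrow> s i j = 0"
    for k and s :: "'i \<Rightarrow> nat \<Rightarrow> 'g hahn"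
    using that
  proof (induction k arbitrary: s rule: inc_induct)
    case base
    then have "s i j = 0" if "i \<in> I" for i j using that by (meson not_le)
    then have "ospan {} undefined = ospan I s"
      by (auto simp: ospan_def intro!: exI[of _ "\<lambda>_. 0"])
    moreover have "{} \<subseteq> {n..<n}" by simp
    moreover have "reduced_family {} id undefined undefined"
      by (simp add: reduced_family_def echelon_family_def)
    ultimately show ?case by (intro exI conjI)
  next
    case (step k)
    show ?case
    proof (cases "\<forall>i\<in>I. s i k = 0")
      case True
      then have "\<forall>i\<in>I. \<forall>j. j < Suc k \<or> n \<le> j \<longrightarrow> s i j = 0"
        using step.prems True by (auto simp: less_Suc_eq)
      from step.IH[OF this] obtain P m w where P: "P \<subseteq> {Suc k..<n}"
        "reduced_family P id m w" "ospan P w = ospan I s" by (elim exE conjE)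
      then have "P \<subseteq> {k..<n}" by auto
      with P(2,3) show ?thesis by (intro exI conjI)
    next
      case False
      \<comment> \<open>A largest entry in absolute value makes all quotients at most 1 in absolute value,
        hence elements of \<open>O\<close>.\<close>
      obtain i0 where i0: "i0 \<in> I" "\<And>i. i \<in> I \<Longrightarrow> \<bar>s i k\<bar> \<le> \<bar>s i0 k\<bar>"
      proof -
        have ne: "(\<lambda>i. \<bar>s i k\<bar>) ` I \<noteq> {}" using False by auto
        have fin: "finite ((\<lambda>i. \<bar>s i k\<bar>) ` I)" using assms(1) by simp
        obtain i where i: "i \<in> I" "Max ((\<lambda>i. \<bar>s i k\<bar>) ` I) = \<bar>s i k\<bar>"
          using Max_in[OF fin ne] by blast
        show ?thesis using Max_ge[OF fin] i(2) by (intro that[OF i(1)]) force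
      qed
      have nz: "s i0 k \<noteq> 0" using False i0 by force
      define c where "c i = s i k / s i0 k" for i
      have c: "exps_ge 0 (c i)" if "i \<in> I" for i
      proof -
        have "\<bar>c i\<bar> \<le> 1" using i0(2)[OF that] nz by (simp add: c_def abs_divide)
        then have "(c i)\<^sup>2 \<le> of_nat 1" by (simp add: abs_square_le_1)
        then show ?thesis by (rule exps_ge_0_if_square_le)
      qed
      obtain e where e: "hcoeff (s i0 k) e \<noteq> 0" "exps_ge e (s i0 k)"
        using hahn_least[OF nz] by (metis exps_ge_def)
      \<comment> \<open>The entry is a power of \<open>t\<close> up to a unit of \<open>O\<close>.\<close>
      define a where "a = tpow e / s i0 k"
      have a: "exps_ge 0 a"
        using exps_ge_mult[OF exps_ge_tpow[of e] exps_ge_inverse[OF e]] by (simp add: a_def divide_inverse)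
      have a': "exps_ge 0 (inverse a)"
        using exps_ge_divide_tpow[OF e(2)] by (simp add: a_def)
      have a_nz: "a \<noteq> 0" using nz by (simp add: a_def)
      define t where "t = (\<lambda>j. a * s i0 j)"
      define s2 where "s2 i = (\<lambda>j. s i j - c i * s i0 j)" for i
      have "\<forall>i\<in>I. \<forall>j. j < Suc k \<or> n \<le> j \<longrightarrow> s2 i j = 0"
        using step.prems i0(1) nz by (auto simp: s2_def c_def less_Suc_eq)
      from step.IH[OF this] obtain P m w where IH: "P \<subseteq> {Suc k..<n}" "reduced_family P id m w"
        "ospan P w = ospan I s2" by (elim exE conjE)
      have E: "echelon_family P id m w" using IH(2) by (simp add: reduced_family_def)
      have finP: "finite P" using echelon_familyD(1)[OF E] .
      have kP: "k \<notin> P" using IH(1) by auto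
      obtain u where u: "(\<lambda>j. u j - t j) \<in> ospan P w" "\<And>p. p \<in> P \<Longrightarrow> exps_less (m p) (u p)"
        using reduce_against_family[OF IH(2)] by metis
      \<comment> \<open>The reduction uses only rows whose pivots come after column \<open>k\<close>.\<close>
      have u_k: "u j = t j" if "j \<le> k" for j
      proof -
        obtain x where "(\<lambda>j. u j - t j) = (\<lambda>j. \<Sum>p\<in>P. x p * w p j)"
          using u(1) unfolding ospan_def by blast
        then have "u j - t j = (\<Sum>p\<in>P. x p * w p j)" by metis
        also have "\<dots> = 0"
          using echelon_familyD(3)[OF E] IH(1) that by (intro sum.neutral) fastforce
        finally show ?thesis by simp
      qed
      let ?P = "insert k P" and ?w = "w(k := u)" and ?m = "m(k := e)"
      have "reduced_family ?P id ?m ?w"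
        using IH(1,2) u(2) kP u_k step.prems i0(1) nz
        by (auto simp: reduced_family_def echelon_family_def t_def a_def)
      moreover have "ospan ?P ?w = ospan I s"
      proof (rule antisym)
        have s0: "s i0 \<in> ospan I s" using ospan_base assms(1) i0(1) .
        have "s2 i \<in> ospan I s" if "i \<in> I" for i
          unfolding s2_def by (intro ospan_diff ospan_smult s0 c that ospan_base assms(1))
        then have sub: "ospan P w \<subseteq> ospan I s" unfolding IH(3) by (rule ospan_mono)
        have "t \<in> ospan I s" unfolding t_def by (intro ospan_smult s0 a)
        then have "u \<in> ospan I s"
          using ospan_add[of t I s "\<lambda>j. u j - t j"] u(1) sub by auto
        then show "ospan ?P ?w \<subseteq> ospan I s"
          using sub ospan_base[OF finP, of _ w] kP by (intro ospan_mono) auto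
        have base: "?w p \<in> ospan ?P ?w" if "p \<in> ?P" for p
          using finP that by (intro ospan_base) auto
        have "w p \<in> ospan ?P ?w" if "p \<in> P" for p
          using base[of p] that kP by (auto split: if_splits)
        then have sub': "ospan P w \<subseteq> ospan ?P ?w" by (rule ospan_mono)
        have "u \<in> ospan ?P ?w" using base[of k] by simp
        then have "t \<in> ospan ?P ?w"
          using ospan_diff[of u ?P ?w "\<lambda>j. u j - t j"] u(1) sub' by auto
        from ospan_smult[OF this a'] have s0': "s i0 \<in> ospan ?P ?w"
          using a_nz by (simp add: t_def mult.assoc[symmetric])
        have "s i \<in> ospan ?P ?w" if "i \<in> I" for i
        proof -
          have "s2 i \<in> ospan ?P ?w" using ospan_base[OF assms(1) that, of s2] IH(3) sub' by blast
          from ospan_add[OF this ospan_smult[OF s0' c[OF that]]] show ?thesis by (simp add: s2_def)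
        qed
        then show "ospan I s \<subseteq> ospan ?P ?w" by (rule ospan_mono)
      qed
      moreover have "?P \<subseteq> {k..<n}" using IH(1) step.hyps by auto
      ultimately show ?thesis by (intro exI conjI)
    qed
  qed
  from this[of 0 s] obtain P m w
    where "P \<subseteq> {0..<n}" "reduced_family P id m w" "ospan P w = ospan I s"
    using assms(2) by auto
  then show ?thesis by (intro that) (auto simp: atLeast0LessThan)
qed

section \<open>Comparison of quadratic forms\<close>

definition dot :: "nat \<Rightarrow> (nat \<Rightarrow> 'a::comm_ring_1) \<Rightarrow> (nat \<Rightarrow> 'a) \<Rightarrow> 'a" where
  "dot n a v = (\<Sum>j<n. a j * v j)"

definition sumsq :: "nat \<Rightarrow> 'i set \<Rightarrow> ('i \<Rightarrow> nat \<Rightarrow> 'a::comm_ring_1) \<Rightarrow> (nat \<Rightarrow> 'a) \<Rightarrow> 'a" where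
  "sumsq n I w v = (\<Sum>i\<in>I. (dot n (w i) v)\<^sup>2)"

lemma dot_add_right: "dot n a (\<lambda>j. v j + u j) = dot n a v + dot n a u"
  by (simp add: dot_def distrib_left sum.distrib)

lemma dot_smult_right: "dot n a (\<lambda>j. c * v j) = c * dot n a v"
  by (simp add: dot_def sum_distrib_left mult_ac)

lemma dot_sum_right: "dot n a (\<lambda>j. \<Sum>i\<in>I. v i j) = (\<Sum>i\<in>I. dot n a (v i))"
  by (simp add: dot_def sum_distrib_left) (rule sum.swap)

lemma dot_sum_left: "dot n (\<lambda>j. \<Sum>i\<in>I. x i * w i j) v = (\<Sum>i\<in>I. x i * dot n (w i) v)"
  by (simp add: dot_def sum_distrib_left sum_distrib_right mult_ac) (rule sum.swap)

lemma dot_unit_right: "j < n \<Longrightarrow> dot n a (\<lambda>c. if c = j then 1 else 0) = a j"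
  by (simp add: dot_def if_distrib[of "\<lambda>c. _ * c"] cong: if_cong)

lemma sumsq_nonneg: "0 \<le> sumsq n I w (v :: nat \<Rightarrow> 'a::linordered_idom)"
  by (simp add: sumsq_def sum_nonneg)

text \<open>The bound has to be uniform in \<open>v\<close>. It is built up row by row from
  \<open>(a + b)\<^sup>2 \<le> 2 a\<^sup>2 + 2 b\<^sup>2\<close> and the bounds on the squares of the coefficients.\<close>

lemma ospan_imp_square_le_sumsq:
  fixes w :: "'i \<Rightarrow> nat \<Rightarrow> 'g::linordered_ab_group_add hahn"
  assumes "finite I" "u \<in> ospan I w"
  shows "\<exists>r::nat. \<forall>v. (dot n u v)\<^sup>2 \<le> of_nat r * sumsq n I w v"
proof -
  obtain x where x: "\<forall>i\<in>I. exps_ge 0 (x i)" "u = (\<lambda>j. \<Sum>i\<in>I. x i * w i j)"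
    using assms unfolding ospan_def by blast
  have "\<exists>r::nat. \<forall>v. (\<Sum>i\<in>I. x i * dot n (w i) v)\<^sup>2 \<le> of_nat r * sumsq n I w v"
    using assms(1) x(1)
  proof (induction I)
    case empty
    show ?case by (simp add: sumsq_def)
  next
    case (insert i I)
    then obtain r :: nat where r: "\<And>v. (\<Sum>i\<in>I. x i * dot n (w i) v)\<^sup>2 \<le> of_nat r * sumsq n I w v"
      by auto
    obtain q :: nat where q: "(x i)\<^sup>2 \<le> of_nat q"
      using insert.prems square_le_if_exps_ge_0 by blast
    have "(\<Sum>i\<in>insert i I. x i * dot n (w i) v)\<^sup>2 \<le> of_nat (2 * (q + r)) * sumsq n (insert i I) w v" for v
    proof -
      let ?b = "dot n (w i) v" and ?S = "\<Sum>i\<in>I. x i * dot n (w i) v" and ?N = "sumsq n I w v"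
      have "(x i * ?b + ?S)\<^sup>2 \<le> 2 * (x i * ?b)\<^sup>2 + 2 * ?S\<^sup>2"
        using zero_le_power2[of "x i * ?b - ?S"] by (simp add: power2_eq_square algebra_simps)
      also have "(x i * ?b)\<^sup>2 \<le> of_nat q * ?b\<^sup>2"
        unfolding power_mult_distrib by (intro mult_right_mono q) simp
      also have "?S\<^sup>2 \<le> of_nat r * ?N" by (rule r)
      also have "2 * (of_nat q * ?b\<^sup>2) + 2 * (of_nat r * ?N) \<le> of_nat (2 * (q + r)) * (?b\<^sup>2 + ?N)"
        using sumsq_nonneg[of n I w v] by (simp add: algebra_simps)
      finally show ?thesis using insert.hyps by (simp add: sumsq_def)
    qed
    then show ?case by blast
  qed
  then show ?thesis unfolding x(2) dot_sum_left .
qed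

lemma ospan_imp_sumsq_le:
  fixes w :: "'i \<Rightarrow> nat \<Rightarrow> 'g::linordered_ab_group_add hahn"
  assumes "finite I" "finite J" "\<And>j. j \<in> J \<Longrightarrow> u j \<in> ospan I w"
  shows "\<exists>r::nat. \<forall>v. sumsq n J u v \<le> of_nat r * sumsq n I w v"
proof -
  have "\<forall>j\<in>J. \<exists>r::nat. \<forall>v. (dot n (u j) v)\<^sup>2 \<le> of_nat r * sumsq n I w v"
    using ospan_imp_square_le_sumsq[OF assms(1) assms(3)] by blast
  then obtain r :: "_ \<Rightarrow> nat" where r: "\<And>j v. j \<in> J \<Longrightarrow> (dot n (u j) v)\<^sup>2 \<le> of_nat (r j) * sumsq n I w v"
    by metis
  have "sumsq n J u v \<le> of_nat (\<Sum>j\<in>J. r j) * sumsq n I w v" for v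
    unfolding sumsq_def[of n J] of_nat_sum sum_distrib_right by (intro sum_mono r)
  then show ?thesis by blast
qed

text \<open>Back substitution from the last pivot: changing the coordinate \<open>k l\<close> of \<open>v\<close> adjusts the value on row
  \<open>l\<close> without affecting the rows with later pivots.\<close>

lemma echelon_family_surjective:
  assumes "echelon_family I k m w" "\<And>i. i \<in> I \<Longrightarrow> k i < n"
  shows "\<exists>v. \<forall>i\<in>I. dot n (w i) v = c i"
proof -
  note E = echelon_familyD[OF assms(1)]
  have "\<exists>v. \<forall>i\<in>I. b \<le> k i \<longrightarrow> dot n (w i) v = c i" if "b \<le> n" for b
    using that
  proof (induction b rule: inc_induct)
    case base
    show ?case using assms(2) by (auto simp: not_le[symmetric])
  next
    case (step b)
    then obtain v where v: "\<And>i. i \<in> I \<Longrightarrow> Suc b \<le> k i \<Longrightarrow> dot n (w i) v = c i" by blast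
    show ?case
    proof (cases "b \<in> k ` I")
      case False
      then have "Suc b \<le> k i" if "i \<in> I" "b \<le> k i" for i
        using that by (metis image_eqI le_neq_implies_less Suc_leI)
      then show ?thesis using v by blast
    next
      case True
      then obtain l where l: "l \<in> I" "k l = b" by blast
      let ?z = "(c l - dot n (w l) v) / tpow (m l)"
      let ?v = "\<lambda>j. v j + ?z * (if j = b then 1 else 0)"
      have dot_v: "dot n (w i) ?v = dot n (w i) v + ?z * w i b" for i
        unfolding dot_add_right dot_smult_right dot_unit_right[OF step.hyps(2)] ..
      have "dot n (w i) ?v = c i" if i: "i \<in> I" "b \<le> k i" for i
      proof (cases "i = l")
        case True
        then show ?thesis using E(4)[OF l(1)] l(2) unfolding dot_v by simp
      next
        case False
        then have "k i \<noteq> b" using E(2) i l by (auto simp: inj_on_def)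
        with i have "b < k i" by simp
        then show ?thesis using E(3)[OF i(1), of b] v[OF i(1)] unfolding dot_v by simp
      qed
      then show ?thesis by blast
    qed
  qed
  from this[of 0] show ?thesis by simp
qed

text \<open>Let \<open>v p\<close> be mapped to the \<open>p\<close>-th unit vector by the family. The bound at \<open>v p\<close> shows that the
  value \<open>x p\<close> of \<open>u\<close> on \<open>v p\<close> lies in \<open>O\<close>. The bound also forces \<open>u\<close> to vanish on the
  common kernel of the rows, and subtracting suitable multiples of the \<open>v p\<close> moves every coordinate vector
  into that kernel; hence \<open>u\<close> is the combination of the rows with coefficients \<open>x p\<close>.\<close>

lemma square_le_sumsq_imp_ospan:
  fixes w :: "'i \<Rightarrow> nat \<Rightarrow> 'g::linordered_ab_group_add hahn"
  assumes ech: "echelon_family I k m w" and kn: "\<And>i. i \<in> I \<Longrightarrow> k i < n"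
    and zero: "\<And>i j. i \<in> I \<Longrightarrow> n \<le> j \<Longrightarrow> w i j = 0" "\<And>j. n \<le> j \<Longrightarrow> u j = 0"
    and bound: "\<And>v. (dot n u v)\<^sup>2 \<le> of_nat r * sumsq n I w v"
  shows "u \<in> ospan I w"
proof -
  note E = echelon_familyD[OF ech]
  have "\<exists>v. \<forall>i\<in>I. dot n (w i) v = (if i = p then 1 else 0)" for p
    by (intro echelon_family_surjective[OF ech] kn)
  then obtain v where v: "\<And>p i. i \<in> I \<Longrightarrow> dot n (w i) (v p) = (if i = p then 1 else 0)" by metis
  define x where "x p = dot n u (v p)" for p
  have x: "exps_ge 0 (x p)" if "p \<in> I" for p
  proof -
    have "sumsq n I w (v p) = (\<Sum>i\<in>I. if i = p then 1 else 0)"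
      unfolding sumsq_def by (rule sum.cong) (simp_all add: v)
    also have "\<dots> = 1" using that E(1) by simp
    finally show ?thesis using bound[of "v p"] by (intro exps_ge_0_if_square_le[of _ r]) (simp add: x_def)
  qed
  have "u j = (\<Sum>p\<in>I. x p * w p j)" for j
  proof (cases "j < n")
    case False
    then show ?thesis using zero by simp
  next
    case True
    let ?e = "\<lambda>c. if c = j then 1 else (0 :: 'g hahn)"
    let ?v = "\<lambda>c. ?e c + (\<Sum>p\<in>I. - w p j * v p c)"
    have dot_v: "dot n a ?v = a j - (\<Sum>p\<in>I. w p j * dot n a (v p))" for a
      unfolding dot_add_right dot_sum_right dot_smult_right dot_unit_right[OF True] by (simp add: sum_negf)
    have "dot n (w i) ?v = 0" if "i \<in> I" for i
    proof -
      have "(\<Sum>p\<in>I. w p j * dot n (w i) (v p)) = (\<Sum>p\<in>I. if p = i then w p j else 0)"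
        by (rule sum.cong) (auto simp: v[OF that])
      then show ?thesis unfolding dot_v using that E(1) by simp
    qed
    then have "sumsq n I w ?v = 0" by (simp add: sumsq_def)
    then have "dot n u ?v = 0" using bound[of ?v] by simp
    then show ?thesis unfolding dot_v by (simp add: x_def mult.commute)
  qed
  then show ?thesis using x unfolding ospan_def by blast
qed

section \<open>Matrices\<close>

definition row_fun :: "'a::zero mat \<Rightarrow> nat \<Rightarrow> nat \<Rightarrow> 'a" where
  "row_fun A i = (\<lambda>j. if j < dim_col A then A $$ (i, j) else 0)"

lemma gram_form_eq_sumsq:
  fixes A :: "'a::comm_ring_1 mat"
  assumes "dim_col A = n"
  shows "vec n v \<bullet> ((A\<^sup>T * A) *\<^sub>v vec n v) = sumsq n {..<dim_row A} (row_fun A) v"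
proof -
  have A: "A \<in> carrier_mat (dim_row A) n" using assms by auto
  have v: "vec n v \<in> carrier_vec n" by simp
  have At: "A\<^sup>T \<in> carrier_mat n (dim_row A)" unfolding transpose_carrier_mat by (rule A)
  have Av: "A *\<^sub>v vec n v \<in> carrier_vec (dim_row A)" using A v by (rule mult_mat_vec_carrier)
  have row: "row A i \<bullet> vec n v = dot n (row_fun A i) v" if "i < dim_row A" for i
    using that assms by (simp add: scalar_prod_def dot_def row_fun_def atLeast0LessThan)
  have "(A\<^sup>T * A) *\<^sub>v vec n v = A\<^sup>T *\<^sub>v (A *\<^sub>v vec n v)"
    by (rule assoc_mult_mat_vec[OF At A v])
  then have "vec n v \<bullet> ((A\<^sup>T * A) *\<^sub>v vec n v) = (A\<^sup>T *\<^sub>v (A *\<^sub>v vec n v)) \<bullet> vec n v"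
    using comm_scalar_prod[OF v mult_mat_vec_carrier[OF At Av]] by simp
  also have "\<dots> = (A *\<^sub>v vec n v) \<bullet> (A *\<^sub>v vec n v)"
    by (rule transpose_vec_mult_scalar[OF A v Av])
  also have "\<dots> = (\<Sum>i<dim_row A. (row A i \<bullet> vec n v)\<^sup>2)"
    by (simp add: scalar_prod_def[of "A *\<^sub>v _"] power2_eq_square atLeast0LessThan)
  also have "\<dots> = sumsq n {..<dim_row A} (row_fun A) v"
    unfolding sumsq_def by (intro sum.cong) (auto simp: row)
  finally show ?thesis .
qed

text \<open>The quadratic form of the Gram matrix of \<open>A\<close> is \<open>\<bar>A v\<bar>\<^sup>2\<close>, and the symmetry conditions in
  \<open>psd_le\<close> hold for all Gram matrices.\<close>

lemma arch_ge_iff_sumsq_le: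
  fixes A B :: "'a::linordered_idom mat"
  assumes dims: "dim_col A = n" "dim_col B = n"
  shows "arch_ge n A B \<longleftrightarrow> (\<exists>r::nat. \<forall>v. sumsq n {..<dim_row A} (row_fun A) v
           \<le> of_nat r * sumsq n {..<dim_row B} (row_fun B) v)"
proof -
  have sym: "(M\<^sup>T * M)\<^sup>T = M\<^sup>T * M" for M :: "'a mat"
    by (subst transpose_mult[of _ "dim_col M" "dim_row M" _ "dim_col M"]) auto
  have car: "M\<^sup>T * M \<in> carrier_mat n n" if "dim_col M = n" for M :: "'a mat"
    using that by auto
  have sym': "(c \<cdot>\<^sub>m (B\<^sup>T * B))\<^sup>T = c \<cdot>\<^sub>m (B\<^sup>T * B)" for c
  proof -
    have "(c \<cdot>\<^sub>m (B\<^sup>T * B))\<^sup>T = c \<cdot>\<^sub>m (B\<^sup>T * B)\<^sup>T" by (rule eq_matI) auto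
    then show ?thesis by (simp add: sym)
  qed
  have smult: "(c \<cdot>\<^sub>m M) *\<^sub>v u = c \<cdot>\<^sub>v (M *\<^sub>v u)" if "dim_vec u = dim_col M" for c :: 'a and M u
    using that by (intro eq_vecI) (auto simp: scalar_prod_def sum_distrib_left mult.assoc)
  have form: "vec n v \<bullet> ((c \<cdot>\<^sub>m (B\<^sup>T * B) - A\<^sup>T * A) *\<^sub>v vec n v) =
      c * sumsq n {..<dim_row B} (row_fun B) v - sumsq n {..<dim_row A} (row_fun A) v" for c v
  proof -
    have "(c \<cdot>\<^sub>m (B\<^sup>T * B) - A\<^sup>T * A) *\<^sub>v vec n v =
        c \<cdot>\<^sub>v ((B\<^sup>T * B) *\<^sub>v vec n v) - (A\<^sup>T * A) *\<^sub>v vec n v"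
      using car[OF dims(1)] car[OF dims(2)] dims
      by (subst minus_mult_distrib_mat_vec[of _ n n]) (auto simp: smult)
    then show ?thesis
      using car[OF dims(1)] car[OF dims(2)] gram_form_eq_sumsq[OF dims(1), of v]
        gram_form_eq_sumsq[OF dims(2), of v] dims
      by (simp add: scalar_prod_minus_distrib[of _ n] mult_mat_vec_carrier)
  qed
  have vec: "(\<forall>v\<in>carrier_vec n. Q v) \<longleftrightarrow> (\<forall>v. Q (vec n v))" for Q :: "'a vec \<Rightarrow> bool"
    by (metis carrier_vecD eq_vecI index_vec dim_vec vec_carrier)
  show ?thesis
    unfolding arch_ge_def psd_le_def vec form using sym sym' car dims by auto
qed

lemma row_fun_index [simp]: "j < dim_col A \<Longrightarrow> row_fun A i j = A $$ (i, j)"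
  by (simp add: row_fun_def)

lemma row_fun_beyond [simp]: "dim_col A \<le> j \<Longrightarrow> row_fun A i j = 0"
  by (simp add: row_fun_def)

lemma arch_ge_trans:
  fixes A B C :: "'a::linordered_idom mat"
  assumes dims: "dim_col A = n" "dim_col B = n" "dim_col C = n"
    and "arch_ge n A B" "arch_ge n B C"
  shows "arch_ge n A C"
proof -
  obtain r q :: nat
    where r: "\<And>v. sumsq n {..<dim_row A} (row_fun A) v \<le> of_nat r * sumsq n {..<dim_row B} (row_fun B) v"
      and q: "\<And>v. sumsq n {..<dim_row B} (row_fun B) v \<le> of_nat q * sumsq n {..<dim_row C} (row_fun C) v"
    using assms by (auto simp: arch_ge_iff_sumsq_le)
  have "sumsq n {..<dim_row A} (row_fun A) v \<le> of_nat (r * q) * sumsq n {..<dim_row C} (row_fun C) v" for v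
    using order_trans[OF r mult_left_mono[OF q of_nat_0_le_iff]] by (simp add: mult.assoc)
  then show ?thesis unfolding arch_ge_iff_sumsq_le[OF dims(1,3)] by blast
qed

lemma ospan_imp_arch_ge:
  assumes "dim_col A = n" "dim_col B = n"
    and "\<And>i. i < dim_row A \<Longrightarrow> row_fun A i \<in> ospan {..<dim_row B} (row_fun B)"
  shows "arch_ge n A B"
  using assms ospan_imp_sumsq_le[of "{..<dim_row B}" "{..<dim_row A}" "row_fun A" "row_fun B" n]
  by (simp add: arch_ge_iff_sumsq_le)

lemma arch_ge_imp_ospan:
  assumes dims: "dim_col A = n" "dim_col C = n"
    and ech: "echelon_family {..<dim_row C} k m (row_fun C)" and kn: "\<And>i. i < dim_row C \<Longrightarrow> k i < n"
    and ge: "arch_ge n A C" and i: "i < dim_row A"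
  shows "row_fun A i \<in> ospan {..<dim_row C} (row_fun C)"
proof -
  obtain r :: nat
    where r: "\<And>v. sumsq n {..<dim_row A} (row_fun A) v \<le> of_nat r * sumsq n {..<dim_row C} (row_fun C) v"
    using ge dims by (auto simp: arch_ge_iff_sumsq_le)
  have "(dot n (row_fun A i) v)\<^sup>2 \<le> sumsq n {..<dim_row A} (row_fun A) v" for v
    unfolding sumsq_def using i by (intro member_le_sum) auto
  then have "(dot n (row_fun A i) v)\<^sup>2 \<le> of_nat r * sumsq n {..<dim_row C} (row_fun C) v" for v
    using r order_trans by blast
  then show ?thesis
    using dims kn by (intro square_le_sumsq_imp_ospan[OF ech, of n _ r]) auto
qed

section \<open>Archimedean canonical forms as reduced families\<close>

lemma canonical_form_reduced_family:
  assumes "archimedean_canonical_form C"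
  obtains m where "reduced_family {..<dim_row C} (pivot_col C) m (row_fun C)"
    and "\<And>i. i < dim_row C \<Longrightarrow> pivot_col C i < dim_col C"
    and "\<And>i j. i < j \<Longrightarrow> j < dim_row C \<Longrightarrow> pivot_col C i < pivot_col C j"
proof -
  let ?k = "pivot_col C"
  have ech: "is_row_echelon C" and nz: "\<And>i. i < dim_row C \<Longrightarrow> \<not> zero_row C i"
    using assms by (auto simp: archimedean_canonical_form_def)
  obtain m where m: "\<And>i. i < dim_row C \<Longrightarrow> C $$ (i, ?k i) = tpow (m i)"
    "\<And>i j \<gamma>. i < dim_row C \<Longrightarrow> j < i \<Longrightarrow> \<gamma> \<ge> m i \<Longrightarrow> hcoeff (C $$ (j, ?k i)) \<gamma> = 0"
    using assms unfolding archimedean_canonical_form_def by blast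
  have k: "?k i < dim_col C" if "i < dim_row C" for i
  proof -
    have "\<exists>j. j < dim_col C \<and> C $$ (i, j) \<noteq> 0" using nz[OF that] by (auto simp: zero_row_def)
    from LeastI_ex[OF this] show ?thesis by (simp add: pivot_col_def)
  qed
  have before: "C $$ (i, j) = 0" if "i < dim_row C" "j < ?k i" for i j
    using not_less_Least[of j "\<lambda>j. j < dim_col C \<and> C $$ (i, j) \<noteq> 0"] that k[of i]
    by (auto simp: pivot_col_def)
  have mono: "?k i < ?k j" if "i < j" "j < dim_row C" for i j
    using that
  proof (induction j)
    case (Suc j)
    have "?k j < ?k (Suc j)" using ech nz Suc.prems by (auto simp: is_row_echelon_def)
    then show ?case using Suc by (cases "i = j") auto
  qed simp
  \<comment> \<open>Canonical forms compare rows by position, reduced families by pivot column.\<close>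
  have less: "i < j" if "?k i < ?k j" "i < dim_row C" "j < dim_row C" for i j
    using mono[of j i] that by (cases i j rule: linorder_cases) auto
  have "inj_on ?k {..<dim_row C}"
    by (rule inj_onI) (metis lessThan_iff linorder_neqE_nat mono nat_neq_iff)
  then have "reduced_family {..<dim_row C} ?k m (row_fun C)"
    using k before m less
    by (auto simp: reduced_family_def echelon_family_def exps_less_def row_fun_def)
  then show ?thesis using that k mono by blast
qed

text \<open>Strictly increasing pivot columns are determined by the set that they form, so the rows of \<open>C\<close> and
  \<open>D\<close> match position by position.\<close>

lemma canonical_form_unique:
  assumes C: "archimedean_canonical_form C" "dim_col C = n"
    and D: "archimedean_canonical_form D" "dim_col D = n"
    and eq: "ospan {..<dim_row C} (row_fun C) = ospan {..<dim_row D} (row_fun D)"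
  shows "C = D"
proof -
  obtain m where c: "reduced_family {..<dim_row C} (pivot_col C) m (row_fun C)"
    "\<And>i j. i < j \<Longrightarrow> j < dim_row C \<Longrightarrow> pivot_col C i < pivot_col C j"
    using canonical_form_reduced_family[OF C(1)] by metis
  obtain q where d: "reduced_family {..<dim_row D} (pivot_col D) q (row_fun D)"
    "\<And>i j. i < j \<Longrightarrow> j < dim_row D \<Longrightarrow> pivot_col D i < pivot_col D j"
    using canonical_form_reduced_family[OF D(1)] by metis
  have "map (pivot_col C) [0..<dim_row C] = map (pivot_col D) [0..<dim_row D]"
    using c(2) d(2) reduced_family_unique(1)[OF c(1) d(1) eq]
    by (intro strict_sorted_equal) (auto simp: sorted_wrt_iff_nth_less atLeast0LessThan)
  then have pivs: "\<forall>i<dim_row C. pivot_col C i = pivot_col D i" and rows: "dim_row C = dim_row D"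
    by (auto simp: list_eq_iff_nth_eq)
  have "row_fun C i = row_fun D i" if "i < dim_row C" for i
    using reduced_family_unique(2)[OF c(1) d(1) eq, of i i] that rows pivs by simp
  then have "row_fun C i j = row_fun D i j" if "i < dim_row C" for i j using that by simp
  then show ?thesis using rows C(2) D(2) by (intro eq_matI) (metis row_fun_index, simp_all)
qed

text \<open>The rows are listed by increasing pivot column.\<close>

lemma reduced_family_canonical_form:
  assumes red: "reduced_family P id m w" and P: "P \<subseteq> {..<n}" and zero: "\<And>p j. p \<in> P \<Longrightarrow> n \<le> j \<Longrightarrow> w p j = 0"
  obtains C where "C \<in> carrier_mat (card P) n" "archimedean_canonical_form C"
    "ospan {..<dim_row C} (row_fun C) = ospan P w"
proof -
  define ps where "ps = sorted_list_of_set P"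
  define C where "C = mat (card P) n (\<lambda>(i, j). w (ps ! i) j)"
  have ech: "echelon_family P id m w" using red by (simp add: reduced_family_def)
  note E = echelon_familyD[OF ech]
  have ps: "set ps = P" "length ps = card P" "sorted_wrt (<) ps"
    using E(1) by (simp_all add: ps_def)
  have psP: "ps ! i \<in> P" if "i < card P" for i using that ps by (metis nth_mem)
  have psn: "ps ! i < n" if "i < card P" for i using psP[OF that] P by auto
  have ps_mono: "ps ! i < ps ! j" if "i < j" "j < card P" for i j
    using ps(2,3) that by (simp add: sorted_wrt_nth_less)
  have dims: "dim_row C = card P" "dim_col C = n" by (simp_all add: C_def)
  have entry: "C $$ (i, j) = w (ps ! i) j" if "i < card P" "j < n" for i j
    using that by (simp add: C_def)
  have pivot: "C $$ (i, ps ! i) = tpow (m (ps ! i))" if "i < card P" for i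
    using entry[OF that psn[OF that]] E(4)[OF psP[OF that]] by simp
  have pivot_col: "pivot_col C i = ps ! i" if "i < card P" for i
    unfolding pivot_col_def
  proof (rule Least_equality)
    show "ps ! i < dim_col C \<and> C $$ (i, ps ! i) \<noteq> 0" using pivot[OF that] psn[OF that] dims by simp
    fix j assume "j < dim_col C \<and> C $$ (i, j) \<noteq> 0"
    then show "ps ! i \<le> j" using entry[OF that] E(3)[OF psP[OF that], of j] dims by force
  qed
  have nz: "\<not> zero_row C i" if "i < card P" for i
    using pivot[OF that] psn[OF that] dims by (metis tpow_nonzero zero_row_def)
  have "archimedean_canonical_form C"
    unfolding archimedean_canonical_form_def
  proof (intro conjI exI[of _ "\<lambda>i. m (ps ! i)"] allI impI)
    show "is_row_echelon C"
      unfolding is_row_echelon_def using nz pivot_col ps_mono dims by auto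
    show "hcoeff (C $$ (j, pivot_col C i)) \<gamma> = 0" if "i < dim_row C" "j < i" "\<gamma> \<ge> m (ps ! i)" for i j \<gamma>
      using red psP[of i] psP[of j] ps_mono[of j i] that dims entry[of j "ps ! i"] psn[of i] pivot_col[of i]
      by (simp add: reduced_family_def exps_less_def)
  qed (use nz pivot pivot_col dims in auto)
  moreover have rows: "row_fun C i = w (ps ! i)" if "i < card P" for i
    using entry[OF that] zero[OF psP[OF that]] dims by (auto simp: row_fun_def fun_eq_iff)
  have "ospan {..<dim_row C} (row_fun C) = ospan P w"
  proof (rule antisym; rule ospan_mono)
    show "row_fun C i \<in> ospan P w" if "i \<in> {..<dim_row C}" for i
      using that rows[of i] ospan_base[OF E(1) psP[of i]] dims by simp
    fix p assume "p \<in> P"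
    then obtain i where "i < card P" "ps ! i = p" using ps by (metis in_set_conv_nth)
    then show "w p \<in> ospan {..<dim_row C} (row_fun C)"
      using ospan_base[of "{..<dim_row C}" i "row_fun C"] rows[of i] dims by simp
  qed
  ultimately show ?thesis using that[of C] dims by auto
qed

theorem proposition6p1:
  fixes n :: nat and A :: "'g::linordered_ab_group_add hahn mat"
  assumes "n \<ge> 1"
    and "A \<in> mats_cols n"
    and "A \<noteq> 0\<^sub>m (dim_row A) n"
  shows "\<exists>!C. C \<in> mats_cols n \<and> archimedean_canonical_form C \<and> arch_equiv n A C"
proof -
  have nA: "dim_col A = n" using assms(2) by (auto simp: mats_cols_def)
  let ?span = "\<lambda>M :: 'g hahn mat. ospan {..<dim_row M} (row_fun M)"
  have base: "row_fun M i \<in> ?span M" if "i < dim_row M" for M :: "'g hahn mat" and i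
    using that by (intro ospan_base) auto
  obtain P m w where P: "P \<subseteq> {..<n}" "reduced_family P id m w" "ospan P w = ?span A"
    using reduced_family_exists[of "{..<dim_row A}" n "row_fun A"] nA by auto
  have finP: "finite P" using P(1) finite_subset by blast
  have "w p j = 0" if "p \<in> P" "n \<le> j" for p j
    using ospan_vanishes_at[of "w p" "{..<dim_row A}" "row_fun A" j] ospan_base[OF finP that(1)] P(3) nA that
    by auto
  then obtain C where C: "C \<in> carrier_mat (card P) n" "archimedean_canonical_form C" "?span C = ?span A"
    using reduced_family_canonical_form[OF P(2,1)] P(3) by metis
  \<comment> \<open>A matrix in \<open>mats_cols n\<close> has at least one row, so the zero module must be excluded.\<close>
  have "P \<noteq> {}"
  proof
    assume "P = {}"
    then have "?span A = {\<lambda>_. 0}" using P(3) by (simp add: ospan_def)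
    then have "row_fun A i j = 0" if "i < dim_row A" for i j
      using base[OF that] by simp
    then have "A $$ (i, j) = 0" if "i < dim_row A" "j < n" for i j
      using that nA by (metis row_fun_index)
    then have "A = 0\<^sub>m (dim_row A) n"
      using nA by (intro eq_matI) auto
    with assms(3) show False by simp
  qed
  then have "C \<in> mats_cols n"
    using C(1) finP by (auto simp: mats_cols_def Suc_le_eq card_gt_0_iff)
  moreover have "arch_equiv n A C"
    unfolding arch_equiv_def using C nA base by (metis carrier_matD(2) ospan_imp_arch_ge)
  moreover have "D = C" if D: "D \<in> mats_cols n" "archimedean_canonical_form D" "arch_equiv n A D" for D
  proof (rule canonical_form_unique[OF D(2) _ C(2)])
    show nD: "dim_col D = n" and nC: "dim_col C = n" using D(1) C(1) by (auto simp: mats_cols_def)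
    have le: "?span M \<subseteq> ?span N"
      if MN: "dim_col M = n" "dim_col N = n" "archimedean_canonical_form N" "arch_ge n M N"
      for M N :: "'g hahn mat"
    proof -
      obtain m where "reduced_family {..<dim_row N} (pivot_col N) m (row_fun N)"
        "\<And>i. i < dim_row N \<Longrightarrow> pivot_col N i < n"
        using canonical_form_reduced_family[OF MN(3)] MN(2) by metis
      then show ?thesis
        using arch_ge_imp_ospan[OF MN(1,2) _ _ MN(4)]
        by (intro ospan_mono) (auto simp: reduced_family_def)
    qed
    have "arch_ge n D C" "arch_ge n C D"
      using arch_ge_trans nA nC nD \<open>arch_equiv n A C\<close> D(3) unfolding arch_equiv_def by blast+
    then show "?span D = ?span C" using le nC nD C(2) D(2) by (intro antisym) auto
  qed
  ultimately show ?thesis using C(2) by blast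
qed

end
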